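(* Let $\mathcal U$ be a non-trivial (i.e. free) ultrafilter on $\mathbb N$ and let $X$ be a real Banach lattice with $\dim X\ge2$. Then $$\lambda^+(X)=\lambda^+(X^{**})=\lambda^+(X_{\mathcal U})\quad\text{and}\quad \beta(X)=\beta(X^{**})=\beta(X_{\mathcal U}).$$
   Context: For a Banach lattice $X$, $S_X^+$ denotes the set of elements $x\in X$ with $x\ge 0$ and $\|x\|=1$. The lattice Schäffer constant is $\lambda^+(X)=\inf\{\max\{\|x-y\|,\|x+y\|\} : x,y\in S_X^+\}$. For $\dim X\ge2$, $\beta(X)=\inf\{\|x\vee y\| : x,y\in S_X^+,\ x\wedge y=0\}$. $X^{**}$ is the bidual with its usual Banach lattice structure. The ultrapower is $X_{\mathcal U}=\ell_\infty(X)/c_{0,\mathcal U}(X)$ with the quotient norm, where $\ell_\infty(X)$ is the space of bounded sequences in $X$ with the supremum norm and $c_{0,\mathcal U}(X)=\{(x_n)\in\ell_\infty(X) : \lim_{\mathcal U}\|x_n\|=0\}$; it is a Banach lattice under $(x_n)_{\mathcal U}\vee(y_n)_{\mathcal U}=(x_n\vee y_n)_{\mathcal U}$ and $(x_n)_{\mathcal U}\wedge(y_n)_{\mathcal U}=(x_n\wedge y_n)_{\mathcal U}$, where $(x_n)_{\mathcal U}$ is the class of $(x_n)$, and $\|(x_n)_{\mathcal U}\|=\lim_{\mathcal U}\|x_n\|$. *)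

theory Defs
  imports "HOL-Analysis.Analysis" "HOL-Library.Lattice_Algebras"
begin

section \<open>Banach lattices\<close>

text \<open>
  In \<^class>\<open>lattice_ab_group_add_abs\<close> the absolute value is
  \<open>\<bar>x\<bar> = sup x (- x)\<close>; the last axiom says that the norm is a lattice norm.
\<close>

class banach_lattice = banach + ordered_real_vector + lattice_ab_group_add_abs +
  assumes norm_lattice_mono: "\<bar>x\<bar> \<le> \<bar>y\<bar> \<Longrightarrow> norm x \<le> norm y"

instance real :: banach_lattice
  by standard auto

lemma abs_banach_lattice_ge:
  fixes x :: "'a::banach_lattice"
  shows "x \<le> \<bar>x\<bar>" "- x \<le> \<bar>x\<bar>" "0 \<le> \<bar>x\<bar>"
  by (rule abs_ge_self abs_ge_minus_self abs_ge_zero)+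

lemma abs_interval_iff:
  fixes x :: "'a::banach_lattice"
  assumes "0 \<le> b"
  shows "x \<in> {- b..b} \<longleftrightarrow> \<bar>x\<bar> \<le> \<bar>b\<bar>"
  unfolding abs_of_nonneg[OF assms] abs_lattice[of x] atLeastAtMost_iff le_sup_iff
  by (metis minus_le_iff)

lemma norm_le_of_abs_le:
  fixes x b :: "'a::banach_lattice"
  shows "\<bar>x\<bar> \<le> b \<Longrightarrow> norm x \<le> norm b"
  by (rule norm_lattice_mono) (rule order_trans[OF _ abs_banach_lattice_ge(1)])

lemma norm_pos_mono:
  fixes x y :: "'a::banach_lattice"
  assumes "0 \<le> x" "x \<le> y"
  shows "norm x \<le> norm y"
  using assms by (intro norm_le_of_abs_le) simp

lemma norm_abs_banach_lattice:
  fixes x :: "'a::banach_lattice"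
  shows "norm \<bar>x\<bar> = norm x"
  by (intro antisym norm_lattice_mono) auto

lemma norm_sup_le:
  fixes x y :: "'a::banach_lattice"
  shows "norm (sup x y) \<le> norm x + norm y"
proof -
  have "\<bar>sup x y\<bar> \<le> \<bar>x\<bar> + \<bar>y\<bar>"
  proof -
    have "x \<le> \<bar>x\<bar> + \<bar>y\<bar>" "y \<le> \<bar>x\<bar> + \<bar>y\<bar>" "- x \<le> \<bar>x\<bar> + \<bar>y\<bar>"
      by (auto intro: add_increasing add_increasing2 abs_banach_lattice_ge)
    moreover have "- sup x y \<le> - x" by simp
    ultimately show ?thesis
      by (subst abs_lattice) (meson le_supI order_trans)
  qed
  then have "norm (sup x y) \<le> norm (\<bar>x\<bar> + \<bar>y\<bar>)"
    by (rule norm_le_of_abs_le)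
  also have "\<dots> \<le> norm x + norm y"
    using norm_triangle_ineq[of "\<bar>x\<bar>" "\<bar>y\<bar>"] by (simp add: norm_abs_banach_lattice)
  finally show ?thesis .
qed

lemma norm_inf_le:
  fixes x y :: "'a::banach_lattice"
  shows "norm (inf x y) \<le> norm x + norm y"
  unfolding inf_eq_neg_sup[of x y] norm_minus_cancel
  using norm_sup_le[of "- x" "- y"] by (simp only: norm_minus_cancel)

lemma sup_diff_le:
  fixes x y x' y' :: "'a::banach_lattice"
  shows "sup x y - sup x' y' \<le> \<bar>x - x'\<bar> + \<bar>y - y'\<bar>"
proof -
  have 1: "x - x' \<le> \<bar>x - x'\<bar> + \<bar>y - y'\<bar>" "y - y' \<le> \<bar>x - x'\<bar> + \<bar>y - y'\<bar>"
    by (auto intro: add_increasing add_increasing2 abs_banach_lattice_ge)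
  have "x \<le> sup x' y' + (\<bar>x - x'\<bar> + \<bar>y - y'\<bar>)"
    using add_mono[OF sup_ge1[of x' y'] 1(1)] by simp
  moreover have "y \<le> sup x' y' + (\<bar>x - x'\<bar> + \<bar>y - y'\<bar>)"
    using add_mono[OF sup_ge2[of y' x'] 1(2)] by simp
  ultimately show ?thesis
    unfolding diff_le_eq add.commute[of _ "sup x' y'"] by (rule le_supI)
qed

lemma norm_sup_diff_le:
  fixes x y x' y' :: "'a::banach_lattice"
  shows "norm (sup x y - sup x' y') \<le> norm (x - x') + norm (y - y')"
proof -
  have "\<bar>sup x y - sup x' y'\<bar> \<le> \<bar>x - x'\<bar> + \<bar>y - y'\<bar>"
    unfolding abs_lattice[of "sup x y - sup x' y'"] minus_diff_eq
    using sup_diff_le[of x y x' y'] sup_diff_le[of x' y' x y]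
    unfolding abs_minus_commute[of x' x] abs_minus_commute[of y' y] by (rule le_supI)
  then have "norm (sup x y - sup x' y') \<le> norm (\<bar>x - x'\<bar> + \<bar>y - y'\<bar>)"
    by (rule norm_le_of_abs_le)
  also have "\<dots> \<le> norm (x - x') + norm (y - y')"
    using norm_triangle_ineq[of "\<bar>x - x'\<bar>" "\<bar>y - y'\<bar>"]
    by (simp add: norm_abs_banach_lattice)
  finally show ?thesis .
qed

lemma norm_inf_diff_le:
  fixes x y x' y' :: "'a::banach_lattice"
  shows "norm (inf x y - inf x' y') \<le> norm (x - x') + norm (y - y')"
proof -
  have "inf x y - inf x' y' = - (sup (- x) (- y) - sup (- x') (- y'))"
    unfolding inf_eq_neg_sup[of x y] inf_eq_neg_sup[of x' y'] by (rule minus_diff_minus)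
  then have "norm (inf x y - inf x' y') = norm (sup (- x) (- y) - sup (- x') (- y'))"
    by (simp only: norm_minus_cancel)
  also have "\<dots> \<le> norm (- x - - x') + norm (- y - - y')"
    by (rule norm_sup_diff_le)
  finally show ?thesis
    by (simp only: minus_diff_minus norm_minus_cancel)
qed

lemma Riesz_decomposition:
  fixes a b z :: "'a::banach_lattice"
  assumes "0 \<le> a" "0 \<le> b" "0 \<le> z" "z \<le> a + b"
  obtains u v where "z = u + v" "0 \<le> u" "u \<le> a" "0 \<le> v" "v \<le> b"
proof
  show "z = inf z a + (z - inf z a)" "0 \<le> inf z a" "inf z a \<le> a" "0 \<le> z - inf z a"
    using assms by (simp_all only: add_diff_inverse diff_ge_0_iff_ge inf_le1 inf_le2
        le_inf_iff diff_add_cancel add.commute[of "inf z a"])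
  have "z - b \<le> inf z a"
    using assms by (intro le_infI) (simp_all only: diff_le_eq le_add_same_cancel1)
  then show "z - inf z a \<le> b"
    by (simp only: diff_le_eq add.commute[of b])
qed


section \<open>The dual Banach lattice\<close>

text \<open>
  The dual space is a copy of \<^typ>\<open>'a \<Rightarrow>\<^sub>L real\<close>, which is a separate type only in order to
  carry the order.
\<close>

typedef (overloaded) 'a dual_space = "UNIV :: ('a::real_normed_vector \<Rightarrow>\<^sub>L real) set"
  morphisms blinfun_of_dual dual_of_blinfun
  by simp

setup_lifting type_definition_dual_space

lift_definition dual_apply :: "'a::real_normed_vector dual_space \<Rightarrow> 'a \<Rightarrow> real"
  is blinfun_apply .

instantiation dual_space :: (real_normed_vector) real_normed_vector
begin

lift_definition norm_dual_space :: "'a dual_space \<Rightarrow> real" is norm .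
lift_definition zero_dual_space :: "'a dual_space" is 0 .
lift_definition plus_dual_space :: "'a dual_space \<Rightarrow> 'a dual_space \<Rightarrow> 'a dual_space" is "(+)" .
lift_definition minus_dual_space :: "'a dual_space \<Rightarrow> 'a dual_space \<Rightarrow> 'a dual_space" is "(-)" .
lift_definition uminus_dual_space :: "'a dual_space \<Rightarrow> 'a dual_space" is uminus .
lift_definition scaleR_dual_space :: "real \<Rightarrow> 'a dual_space \<Rightarrow> 'a dual_space" is scaleR .

definition dist_dual_space :: "'a dual_space \<Rightarrow> 'a dual_space \<Rightarrow> real"
  where "dist_dual_space f g = norm (f - g)"

definition uniformity_dual_space :: "('a dual_space \<times> 'a dual_space) filter"
  where "uniformity_dual_space = (INF e\<in>{0<..}. principal {(x, y). dist x y < e})"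

definition open_dual_space :: "'a dual_space set \<Rightarrow> bool"
  where "open_dual_space S = (\<forall>x\<in>S. \<forall>\<^sub>F (x', y) in uniformity. x' = x \<longrightarrow> y \<in> S)"

definition sgn_dual_space :: "'a dual_space \<Rightarrow> 'a dual_space"
  where "sgn_dual_space x = scaleR (inverse (norm x)) x"

instance
  apply standard
  apply (simp_all only: dist_dual_space_def uniformity_dual_space_def open_dual_space_def
      sgn_dual_space_def)
  apply (transfer, simp add: algebra_simps norm_triangle_ineq)+
  done

end

lemma dual_space_eqI: "(\<And>x. dual_apply f x = dual_apply g x) \<Longrightarrow> f = g"
  by transfer (auto intro: blinfun_eqI)

lemma dual_apply_simps [simp]:
  "dual_apply 0 x = 0"
  "dual_apply (f + g) x = dual_apply f x + dual_apply g x"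
  "dual_apply (f - g) x = dual_apply f x - dual_apply g x"
  "dual_apply (- f) x = - dual_apply f x"
  "dual_apply (c *\<^sub>R f) x = c * dual_apply f x"
  "dual_apply f 0 = 0"
  "dual_apply f (x + y) = dual_apply f x + dual_apply f y"
  "dual_apply f (x - y) = dual_apply f x - dual_apply f y"
  "dual_apply f (- x) = - dual_apply f x"
  "dual_apply f (c *\<^sub>R x) = c * dual_apply f x"
  by (transfer, simp add: blinfun.bilinear_simps)+

lemma norm_dual_apply_le: "\<bar>dual_apply f x\<bar> \<le> norm f * norm x"
  by transfer (metis norm_blinfun real_norm_def)

lemma norm_dual_bound:
  "0 \<le> b \<Longrightarrow> (\<And>x. \<bar>dual_apply f x\<bar> \<le> b * norm x) \<Longrightarrow> norm f \<le> b"
  by transfer (auto intro: norm_blinfun_bound)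

instance dual_space :: (real_normed_vector) banach
proof
  fix X :: "nat \<Rightarrow> 'a dual_space"
  have d: "dist f g = dist (blinfun_of_dual f) (blinfun_of_dual g)" for f g :: "'a dual_space"
    by (simp add: dist_norm norm_dual_space.rep_eq minus_dual_space.rep_eq)
  assume "Cauchy X"
  then have "Cauchy (\<lambda>n. blinfun_of_dual (X n))"
    by (simp add: Cauchy_def d)
  then obtain l where "(\<lambda>n. blinfun_of_dual (X n)) \<longlonglongrightarrow> l"
    using Cauchy_convergent convergentD by blast
  then have "X \<longlonglongrightarrow> dual_of_blinfun l"
    by (simp add: lim_sequentially d dual_of_blinfun_inverse)
  then show "convergent X" by (rule convergentI)
qed

text \<open>The positive part of a functional, by the Riesz--Kantorovich formula.\<close>

lemma dual_pos_part_exists: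
  fixes f :: "'a::banach_lattice dual_space"
  shows "\<exists>h :: 'a dual_space. \<forall>x. bdd_above (dual_apply f ` {0..x}) \<and>
    (0 \<le> x \<longrightarrow> dual_apply h x = (SUP y\<in>{0..x}. dual_apply f y))"
proof -
  define p where "p x = (SUP y\<in>{0..x}. dual_apply f y)" for x
  have fb: "dual_apply f y \<le> norm f * norm x" if "0 \<le> y" "y \<le> x" for x y
  proof -
    have "dual_apply f y \<le> norm f * norm y"
      using norm_dual_apply_le[of f y] by simp
    also have "\<dots> \<le> norm f * norm x"
      by (intro mult_left_mono norm_pos_mono that) simp
    finally show ?thesis .
  qed
  have bdd: "bdd_above (dual_apply f ` {0..x})" for x
    by (rule bdd_aboveI[of _ "norm f * norm x"]) (auto intro: fb)
  have p_upper: "dual_apply f y \<le> p x" if "0 \<le> y" "y \<le> x" for x y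
    unfolding p_def using that by (intro cSUP_upper bdd) auto
  have p_least: "p x \<le> b" if "0 \<le> x" "\<And>y. 0 \<le> y \<Longrightarrow> y \<le> x \<Longrightarrow> dual_apply f y \<le> b" for x b
    unfolding p_def using that by (intro cSUP_least) auto
  have p_nonneg: "0 \<le> p x" if "0 \<le> x" for x
    using p_upper[of 0 x] that by simp
  have p_le: "p x \<le> norm f * norm x" if "0 \<le> x" for x
    using that by (intro p_least fb)
  have p_add: "p (a + b) = p a + p b" if ab: "0 \<le> a" "0 \<le> b" for a b
  proof (rule antisym)
    show "p (a + b) \<le> p a + p b"
    proof (rule p_least)
      fix y assume y: "0 \<le> y" "y \<le> a + b"
      obtain u v where "y = u + v" "0 \<le> u" "u \<le> a" "0 \<le> v" "v \<le> b"
        using Riesz_decomposition[OF ab y] .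
      then show "dual_apply f y \<le> p a + p b"
        by (simp add: add_mono p_upper)
    qed (use ab in simp)
    have "p a \<le> p (a + b) - p b"
    proof (rule p_least[OF ab(1)])
      fix u assume u: "0 \<le> u" "u \<le> a"
      have "p b \<le> p (a + b) - dual_apply f u"
      proof (rule p_least[OF ab(2)])
        fix v assume v: "0 \<le> v" "v \<le> b"
        have "dual_apply f (u + v) \<le> p (a + b)"
          using u v by (intro p_upper add_mono add_nonneg_nonneg)
        then show "dual_apply f v \<le> p (a + b) - dual_apply f u" by simp
      qed
      then show "dual_apply f u \<le> p (a + b) - p b" by simp
    qed
    then show "p a + p b \<le> p (a + b)" by simp
  qed
  have p_scale_le: "p (c *\<^sub>R a) \<le> c * p a" if "0 < c" "0 \<le> a" for c a
  proof (rule p_least)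
    fix y assume y: "0 \<le> y" "y \<le> c *\<^sub>R a"
    have "inverse c *\<^sub>R y \<le> inverse c *\<^sub>R (c *\<^sub>R a)"
      using that y by (intro scaleR_left_mono) auto
    then have "dual_apply f (inverse c *\<^sub>R y) \<le> p a"
      using that y by (intro p_upper) (auto intro: scaleR_nonneg_nonneg)
    then show "dual_apply f y \<le> c * p a"
      using that by (simp add: field_simps)
  qed (use that in \<open>auto intro: scaleR_nonneg_nonneg\<close>)
  have p_0: "p 0 = 0" using p_add[of 0 0] by simp
  have p_scale: "p (c *\<^sub>R a) = c * p a" if "0 \<le> c" "0 \<le> a" for c a
  proof (cases "c = 0")
    case False
    then have c: "0 < c" using that by simp
    have "p (inverse c *\<^sub>R (c *\<^sub>R a)) \<le> inverse c * p (c *\<^sub>R a)"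
      using c that by (intro p_scale_le) (auto intro: scaleR_nonneg_nonneg)
    then have "c * p a \<le> p (c *\<^sub>R a)" using c by (simp add: field_simps)
    with p_scale_le[OF c that(2)] show ?thesis by simp
  qed (simp add: p_0)
  define F where "F x = p (pprt x) - p (- nprt x)" for x
  have F_eq: "F (a - b) = p a - p b" if "0 \<le> a" "0 \<le> b" for a b
  proof -
    have "pprt (a - b) + b = - nprt (a - b) + a"
      using prts[of "a - b"] by (simp add: algebra_simps)
    then have "p (pprt (a - b)) + p b = p (- nprt (a - b)) + p a"
      using that by (subst p_add[symmetric]) (auto simp: p_add[symmetric])
    then show ?thesis by (simp add: F_def)
  qed
  have prt: "x = pprt x - (- nprt x)" for x :: 'a
    using prts[of x] by simp
  have nn: "0 \<le> - nprt x" for x :: 'a by simp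
  have F_add: "F (x + y) = F x + F y" for x y
  proof -
    have "x + y = (pprt x + pprt y) - (- nprt x + - nprt y)"
      using prts[of x] prts[of y] by (metis add.assoc add.left_commute diff_minus_eq_add minus_add_distrib)
    then have "F (x + y) = p (pprt x + pprt y) - p (- nprt x + - nprt y)"
      using F_eq[of "pprt x + pprt y" "- nprt x + - nprt y"] nn[of x] nn[of y]
      by (metis add_nonneg_nonneg zero_le_pprt)
    also have "\<dots> = F x + F y"
      unfolding F_def by (subst p_add; simp)+
    finally show ?thesis .
  qed
  have F_scale_pos: "F (c *\<^sub>R x) = c * F x" if "0 \<le> c" for c x
  proof -
    have "c *\<^sub>R x = c *\<^sub>R pprt x - c *\<^sub>R (- nprt x)"
      using prt[of x] by (metis scaleR_diff_right)
    then have "F (c *\<^sub>R x) = p (c *\<^sub>R pprt x) - p (c *\<^sub>R (- nprt x))"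
      using F_eq[of "c *\<^sub>R pprt x" "c *\<^sub>R (- nprt x)"] that nn[of x]
      by (metis scaleR_nonneg_nonneg zero_le_pprt)
    also have "\<dots> = c * F x"
      unfolding F_def using p_scale[OF that zero_le_pprt[of x]] p_scale[OF that nn[of x]]
      by (simp add: right_diff_distrib)
    finally show ?thesis .
  qed
  have F_neg: "F (- x) = - F x" for x
    using F_add[of x "- x"] by (simp add: F_def p_0)
  have F_scale: "F (c *\<^sub>R x) = c * F x" for c x
  proof (cases "0 \<le> c")
    case False
    then have "F ((- c) *\<^sub>R x) = (- c) * F x" by (intro F_scale_pos) simp
    then show ?thesis using F_neg[of "c *\<^sub>R x"] by simp
  qed (rule F_scale_pos)
  have prt_abs: "pprt x \<le> \<bar>x\<bar>" "- nprt x \<le> \<bar>x\<bar>" for x :: 'a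
    by (simp_all add: abs_prts)
  have F_bound: "norm (F x) \<le> norm x * norm f" for x
  proof -
    have *: "p y \<le> norm x * norm f" if "0 \<le> y" "y \<le> \<bar>x\<bar>" for y
    proof -
      have "p y \<le> norm f * norm y" using that by (intro p_le)
      also have "\<dots> \<le> norm f * norm \<bar>x\<bar>"
        by (intro mult_left_mono norm_pos_mono that) simp
      finally show ?thesis by (simp add: norm_abs_banach_lattice mult.commute)
    qed
    show ?thesis
      using *[OF zero_le_pprt prt_abs(1)] *[OF nn prt_abs(2)]
        p_nonneg[OF zero_le_pprt[of x]] p_nonneg[OF nn[of x]]
      by (auto simp: F_def)
  qed
  have "bounded_linear F"
  proof (rule bounded_linear_intro)
    show "F (x + y) = F x + F y" for x y by (rule F_add)
    show "F (c *\<^sub>R x) = c *\<^sub>R F x" for c x by (simp add: F_scale)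
    show "norm (F x) \<le> norm x * norm f" for x by (rule F_bound)
  qed
  then have app: "dual_apply (dual_of_blinfun (Blinfun F)) x = F x" for x
    by (simp add: dual_apply.rep_eq dual_of_blinfun_inverse bounded_linear_Blinfun_apply)
  have *: "dual_apply (dual_of_blinfun (Blinfun F)) x = (SUP y\<in>{0..x}. dual_apply f y)"
    if "0 \<le> x" for x
    using that by (simp add: app F_def p_0 flip: p_def)
  show ?thesis
    by (intro exI[of _ "dual_of_blinfun (Blinfun F)"] allI conjI impI bdd *)
qed

instantiation dual_space :: (banach_lattice) order
begin

definition less_eq_dual_space :: "'a dual_space \<Rightarrow> 'a dual_space \<Rightarrow> bool"
  where "f \<le> g \<longleftrightarrow> (\<forall>x\<ge>0. dual_apply f x \<le> dual_apply g x)"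

definition less_dual_space :: "'a dual_space \<Rightarrow> 'a dual_space \<Rightarrow> bool"
  where "f < g \<longleftrightarrow> f \<le> g \<and> \<not> g \<le> f" for f g :: "'a dual_space"

instance
proof
  fix f g h :: "'a dual_space"
  show "f < g \<longleftrightarrow> f \<le> g \<and> \<not> g \<le> f" by (rule less_dual_space_def)
  show "f \<le> f" by (simp add: less_eq_dual_space_def)
  show "f \<le> g \<Longrightarrow> g \<le> h \<Longrightarrow> f \<le> h"
    unfolding less_eq_dual_space_def by (meson order_trans)
  assume "f \<le> g" "g \<le> f"
  then have *: "dual_apply f x = dual_apply g x" if "0 \<le> x" for x
    using that by (auto simp: less_eq_dual_space_def intro: antisym)
  show "f = g"
  proof (rule dual_space_eqI)
    fix x
    have "dual_apply f (pprt x - (- nprt x)) = dual_apply g (pprt x - (- nprt x))"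
      using *[of "pprt x"] *[of "- nprt x"] by simp
    then show "dual_apply f x = dual_apply g x" by (simp flip: prts)
  qed
qed

end

instantiation dual_space :: (banach_lattice) "{sup, inf, abs}"
begin

definition sup_dual_space :: "'a dual_space \<Rightarrow> 'a dual_space \<Rightarrow> 'a dual_space"
  where "sup_dual_space f g = (THE h. f \<le> h \<and> g \<le> h \<and> (\<forall>k. f \<le> k \<longrightarrow> g \<le> k \<longrightarrow> h \<le> k))"

definition inf_dual_space :: "'a dual_space \<Rightarrow> 'a dual_space \<Rightarrow> 'a dual_space"
  where "inf_dual_space f g = (THE h. h \<le> f \<and> h \<le> g \<and> (\<forall>k. k \<le> f \<longrightarrow> k \<le> g \<longrightarrow> k \<le> h))"

definition abs_dual_space :: "'a dual_space \<Rightarrow> 'a dual_space"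
  where "abs_dual_space f = sup f (- f)"

instance ..

end

lemma dual_sup_exists:
  fixes f g :: "'a::banach_lattice dual_space"
  shows "\<exists>h. f \<le> h \<and> g \<le> h \<and> (\<forall>k. f \<le> k \<longrightarrow> g \<le> k \<longrightarrow> h \<le> k) \<and>
    (\<forall>x. bdd_above (dual_apply (f - g) ` {0..x}) \<and>
      (0 \<le> x \<longrightarrow>
        dual_apply h x = dual_apply g x + (SUP y\<in>{0..x}. dual_apply (f - g) y)))"
proof -
  obtain q where q: "\<And>x. 0 \<le> x \<Longrightarrow> dual_apply q x = (SUP y\<in>{0..x}. dual_apply (f - g) y)"
    and b: "\<And>x. bdd_above (dual_apply (f - g) ` {0..x})"
    using dual_pos_part_exists[of "f - g"] by metis
  have up: "dual_apply (f - g) y \<le> dual_apply q x" if "0 \<le> y" "y \<le> x" for x y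
    using that order_trans[OF that] by (simp only: q) (intro cSUP_upper b, simp)
  show ?thesis
  proof (intro exI[of _ "g + q"] conjI allI impI)
    show "f \<le> g + q"
      unfolding less_eq_dual_space_def
    proof (intro allI impI)
      fix x :: 'a assume "0 \<le> x"
      then show "dual_apply f x \<le> dual_apply (g + q) x"
        using up[of x x] by simp
    qed
    show "g \<le> g + q"
      unfolding less_eq_dual_space_def
    proof (intro allI impI)
      fix x :: 'a assume "0 \<le> x"
      then show "dual_apply g x \<le> dual_apply (g + q) x"
        using up[of 0 x] by simp
    qed
    show "g + q \<le> k" if k: "f \<le> k" "g \<le> k" for k
      unfolding less_eq_dual_space_def
    proof (intro allI impI)
      fix x :: 'a assume x: "0 \<le> x"
      have "dual_apply q x \<le> dual_apply (k - g) x"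
        unfolding q[OF x]
      proof (rule cSUP_least)
        fix y assume "y \<in> {0..x}"
        then have y: "0 \<le> y" "0 \<le> x - y" by auto
        then have "dual_apply (f - g) y \<le> dual_apply (k - g) y"
          using k(1) by (simp add: less_eq_dual_space_def)
        moreover have "0 \<le> dual_apply (k - g) (x - y)"
          using k(2) y(2) unfolding less_eq_dual_space_def
          by (metis diff_ge_0_iff_ge dual_apply_simps(3))
        ultimately show "dual_apply (f - g) y \<le> dual_apply (k - g) x"
          by simp
      qed (use x in auto)
      then show "dual_apply (g + q) x \<le> dual_apply k x" by simp
    qed
    show "dual_apply (g + q) x = dual_apply g x + (SUP y\<in>{0..x}. dual_apply (f - g) y)"
      if "0 \<le> x" for x
      using q[OF that] by simp
    show "bdd_above (dual_apply (f - g) ` {0..x})" for x by (rule b)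
  qed
qed

lemma dual_neg_le_iff: "- f \<le> - g \<longleftrightarrow> g \<le> f" for f g :: "'a::banach_lattice dual_space"
  by (simp add: less_eq_dual_space_def)

lemma dual_inf_exists:
  fixes f g :: "'a::banach_lattice dual_space"
  shows "\<exists>h. h \<le> f \<and> h \<le> g \<and> (\<forall>k. k \<le> f \<longrightarrow> k \<le> g \<longrightarrow> k \<le> h)"
proof -
  obtain h where "- f \<le> h" "- g \<le> h" "\<And>k. - f \<le> k \<Longrightarrow> - g \<le> k \<Longrightarrow> h \<le> k"
    using dual_sup_exists[of "- f" "- g"] by metis
  then show ?thesis
    by (intro exI[of _ "- h"]) (metis dual_neg_le_iff minus_minus)
qed

lemma dual_sup_eq:
  fixes f g :: "'a::banach_lattice dual_space"
  assumes "f \<le> h" "g \<le> h" "\<And>k. f \<le> k \<Longrightarrow> g \<le> k \<Longrightarrow> h \<le> k"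
  shows "sup f g = h"
  unfolding sup_dual_space_def using assms by (intro the_equality) (auto intro: antisym)

lemma dual_inf_eq:
  fixes f g :: "'a::banach_lattice dual_space"
  assumes "h \<le> f" "h \<le> g" "\<And>k. k \<le> f \<Longrightarrow> k \<le> g \<Longrightarrow> k \<le> h"
  shows "inf f g = h"
  unfolding inf_dual_space_def using assms by (intro the_equality) (auto intro: antisym)

lemma dual_sup_apply:
  fixes f g :: "'a::banach_lattice dual_space"
  assumes "0 \<le> x"
  shows "dual_apply (sup f g) x = dual_apply g x + (SUP y\<in>{0..x}. dual_apply (f - g) y)"
    and "bdd_above (dual_apply (f - g) ` {0..x})"
proof -
  obtain h where h: "f \<le> h" "g \<le> h" "\<And>k. f \<le> k \<Longrightarrow> g \<le> k \<Longrightarrow> h \<le> k"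
    and e: "\<And>x. 0 \<le> x \<Longrightarrow>
      dual_apply h x = dual_apply g x + (SUP y\<in>{0..x}. dual_apply (f - g) y)"
    and b: "\<And>x. bdd_above (dual_apply (f - g) ` {0..x})"
    using dual_sup_exists[of f g] by metis
  show "dual_apply (sup f g) x = dual_apply g x + (SUP y\<in>{0..x}. dual_apply (f - g) y)"
    using e[OF assms] dual_sup_eq[OF h] by simp
  show "bdd_above (dual_apply (f - g) ` {0..x})" by (rule b)
qed

instance dual_space :: (banach_lattice) lattice
proof
  fix f g k :: "'a dual_space"
  obtain h where h: "f \<le> h" "g \<le> h" "\<And>k. f \<le> k \<Longrightarrow> g \<le> k \<Longrightarrow> h \<le> k"
    using dual_sup_exists[of f g] by metis
  note s = dual_sup_eq[OF h]
  show "f \<le> sup f g" "g \<le> sup f g" using h by (simp_all add: s)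
  obtain i where i: "i \<le> f" "i \<le> g" "\<And>k. k \<le> f \<Longrightarrow> k \<le> g \<Longrightarrow> k \<le> i"
    using dual_inf_exists[of f g] by metis
  note t = dual_inf_eq[OF i]
  show "inf f g \<le> f" "inf f g \<le> g" using i by (simp_all add: t)
next
  fix f g k :: "'a dual_space"
  assume a: "f \<le> k" "g \<le> k"
  obtain h where h: "f \<le> h" "g \<le> h" "\<And>k. f \<le> k \<Longrightarrow> g \<le> k \<Longrightarrow> h \<le> k"
    using dual_sup_exists[of f g] by metis
  show "sup f g \<le> k" using h(3)[OF a] by (simp add: dual_sup_eq[OF h])
next
  fix f g k :: "'a dual_space"
  assume a: "k \<le> f" "k \<le> g"
  obtain i where i: "i \<le> f" "i \<le> g" "\<And>k. k \<le> f \<Longrightarrow> k \<le> g \<Longrightarrow> k \<le> i"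
    using dual_inf_exists[of f g] by metis
  show "k \<le> inf f g" using i(3)[OF a] by (simp add: dual_inf_eq[OF i])
qed

instance dual_space :: (banach_lattice) lattice_ab_group_add_abs
proof
  fix f g h :: "'a dual_space"
  show "f \<le> g \<Longrightarrow> h + f \<le> h + g" by (simp add: less_eq_dual_space_def)
  show "\<bar>f\<bar> = sup f (- f)" by (rule abs_dual_space_def)
qed

lemma dual_abs_apply:
  fixes f :: "'a::banach_lattice dual_space"
  assumes "0 \<le> x"
  shows "dual_apply \<bar>f\<bar> x = (SUP z\<in>{-x..x}. dual_apply f z)"
    and "bdd_above (dual_apply f ` {-x..x})"
proof -
  have bound: "dual_apply f z \<le> norm f * norm x" if "z \<in> {-x..x}" for z
  proof -
    have "\<bar>z\<bar> \<le> \<bar>x\<bar>"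
      using that unfolding abs_interval_iff[OF assms] .
    then have "norm f * norm z \<le> norm f * norm x"
      by (intro mult_left_mono norm_lattice_mono) auto
    then show ?thesis using norm_dual_apply_le[of f z] by simp
  qed
  show bdd: "bdd_above (dual_apply f ` {-x..x})"
    by (rule bdd_aboveI[of _ "norm f * norm x"]) (auto intro: bound)
  have ne: "{0..x} \<noteq> {}" "{-x..x} \<noteq> {}"
    using assms abs_interval_iff[OF assms, of x] by auto
  note e = dual_sup_apply[OF assms, of f "- f"]
  have two: "dual_apply (f - - f) y = dual_apply f (2 *\<^sub>R y - x) + dual_apply f x" for y
    by simp
  show "dual_apply \<bar>f\<bar> x = (SUP z\<in>{-x..x}. dual_apply f z)"
  proof (rule antisym)
    have "(SUP y\<in>{0..x}. dual_apply (f - - f) y) \<le> (SUP z\<in>{-x..x}. dual_apply f z) + dual_apply f x"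
    proof (rule cSUP_least[OF ne(1)])
      fix y assume y: "y \<in> {0..x}"
      have "(2::real) *\<^sub>R y \<le> 2 *\<^sub>R x" "0 \<le> (2::real) *\<^sub>R y"
        using y by (auto intro: scaleR_left_mono scaleR_nonneg_nonneg)
      then have "2 *\<^sub>R y - x \<in> {-x..x}" by (simp add: scaleR_2 algebra_simps)
      then have "dual_apply f (2 *\<^sub>R y - x) \<le> (SUP z\<in>{-x..x}. dual_apply f z)"
        by (intro cSUP_upper bdd)
      then show "dual_apply (f - - f) y \<le> (SUP z\<in>{-x..x}. dual_apply f z) + dual_apply f x"
        unfolding two by simp
    qed
    then show "dual_apply \<bar>f\<bar> x \<le> (SUP z\<in>{-x..x}. dual_apply f z)"
      unfolding abs_dual_space_def e(1) by simp
    show "(SUP z\<in>{-x..x}. dual_apply f z) \<le> dual_apply \<bar>f\<bar> x"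
    proof (rule cSUP_least[OF ne(2)])
      fix z assume z: "z \<in> {-x..x}"
      define y where "y = (1/2::real) *\<^sub>R (z + x)"
      have "(1/2::real) *\<^sub>R (z + x) \<le> (1/2::real) *\<^sub>R (x + x)"
        using z by (intro scaleR_left_mono) auto
      moreover have "0 \<le> z + x" using z by (metis atLeastAtMost_iff add.right_inverse
            add_right_mono add.commute)
      ultimately have "y \<in> {0..x}"
        by (auto simp: y_def scaleR_nonneg_nonneg simp flip: scaleR_2)
      then have "dual_apply (f - - f) y \<le> (SUP y\<in>{0..x}. dual_apply (f - - f) y)"
        by (intro cSUP_upper e(2))
      moreover have "2 *\<^sub>R y - x = z" by (simp add: y_def)
      ultimately show "dual_apply f z \<le> dual_apply \<bar>f\<bar> x"
        unfolding abs_dual_space_def e(1) two by simp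
    qed
  qed
qed

lemma dual_apply_le_abs:
  fixes f :: "'a::banach_lattice dual_space"
  shows "\<bar>dual_apply f x\<bar> \<le> dual_apply \<bar>f\<bar> \<bar>x\<bar>"
proof -
  have "x \<in> {-\<bar>x\<bar>..\<bar>x\<bar>}" "- x \<in> {-\<bar>x\<bar>..\<bar>x\<bar>}"
    unfolding abs_interval_iff[OF abs_banach_lattice_ge(3)] by simp_all
  then have "dual_apply f x \<le> dual_apply \<bar>f\<bar> \<bar>x\<bar>" "dual_apply f (- x) \<le> dual_apply \<bar>f\<bar> \<bar>x\<bar>"
    unfolding dual_abs_apply(1)[OF abs_banach_lattice_ge(3)]
    by (intro cSUP_upper dual_abs_apply(2) abs_banach_lattice_ge(3); simp)+
  then show ?thesis by simp
qed

instance dual_space :: (banach_lattice) banach_lattice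
proof
  fix f g :: "'a dual_space" and a b :: real
  show "f \<le> g \<Longrightarrow> 0 \<le> a \<Longrightarrow> a *\<^sub>R f \<le> a *\<^sub>R g"
    by (simp add: less_eq_dual_space_def mult_left_mono)
  show "a \<le> b \<Longrightarrow> 0 \<le> f \<Longrightarrow> a *\<^sub>R f \<le> b *\<^sub>R f"
    by (simp add: less_eq_dual_space_def mult_right_mono)
  assume fg: "\<bar>f\<bar> \<le> \<bar>g\<bar>"
  show "norm f \<le> norm g"
  proof (rule norm_dual_bound)
    fix x :: 'a
    have "\<bar>dual_apply f x\<bar> \<le> dual_apply \<bar>f\<bar> \<bar>x\<bar>" by (rule dual_apply_le_abs)
    also have "\<dots> \<le> dual_apply \<bar>g\<bar> \<bar>x\<bar>"
      using fg unfolding less_eq_dual_space_def by (simp add: abs_banach_lattice_ge(3))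
    also have "\<dots> \<le> norm g * norm x"
      unfolding dual_abs_apply(1)[OF abs_banach_lattice_ge(3)]
    proof (rule cSUP_least)
      show "{- \<bar>x\<bar>..\<bar>x\<bar>} \<noteq> {}"
        using abs_interval_iff[OF abs_banach_lattice_ge(3), of x x] by auto
      fix z assume "z \<in> {- \<bar>x\<bar>..\<bar>x\<bar>}"
      then have "\<bar>z\<bar> \<le> \<bar>x\<bar>"
        unfolding abs_interval_iff[OF abs_banach_lattice_ge(3)] by simp
      then have "norm g * norm z \<le> norm g * norm x"
        by (intro mult_left_mono norm_lattice_mono) auto
      then show "dual_apply g z \<le> norm g * norm x" using norm_dual_apply_le[of g z] by simp
    qed
    finally show "\<bar>dual_apply f x\<bar> \<le> norm g * norm x" .
  qed simp
qed

type_synonym 'a bidual = "'a dual_space dual_space"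


section \<open>The constants\<close>

text \<open>
  The ultrapower depends on the ultrafilter, hence is not a type.  The constants are therefore
  defined for lattices given by an explicit carrier and explicit operations, and
  \<open>lattice_of\<close> turns a type of class \<^class>\<open>banach_lattice\<close> into such a structure.
  The infima are over subsets of the nonnegative reals; the one in \<open>beta_const\<close> is over a
  nonempty set as soon as the dimension is at least 2.
\<close>

record 'a normed_lattice =
  nl_carrier :: "'a set"
  nl_zero :: 'a
  nl_add :: "'a \<Rightarrow> 'a \<Rightarrow> 'a"
  nl_scale :: "real \<Rightarrow> 'a \<Rightarrow> 'a"
  nl_le :: "'a \<Rightarrow> 'a \<Rightarrow> bool"
  nl_join :: "'a \<Rightarrow> 'a \<Rightarrow> 'a"
  nl_meet :: "'a \<Rightarrow> 'a \<Rightarrow> 'a"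
  nl_norm :: "'a \<Rightarrow> real"

definition nl_diff :: "'a normed_lattice \<Rightarrow> 'a \<Rightarrow> 'a \<Rightarrow> 'a"
  where "nl_diff L x y = nl_add L x (nl_scale L (-1) y)"

definition pos_sphere :: "'a normed_lattice \<Rightarrow> 'a set"
  where "pos_sphere L = {x \<in> nl_carrier L. nl_le L (nl_zero L) x \<and> nl_norm L x = 1}"

definition lattice_schaffer :: "'a normed_lattice \<Rightarrow> real"
  where "lattice_schaffer L =
    Inf {max (nl_norm L (nl_diff L x y)) (nl_norm L (nl_add L x y)) | x y.
      x \<in> pos_sphere L \<and> y \<in> pos_sphere L}"

definition beta_const :: "'a normed_lattice \<Rightarrow> real"
  where "beta_const L =
    Inf {nl_norm L (nl_join L x y) | x y.
      x \<in> pos_sphere L \<and> y \<in> pos_sphere L \<and> nl_meet L x y = nl_zero L}"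

definition lattice_of :: "'a::banach_lattice itself \<Rightarrow> 'a normed_lattice"
  where "lattice_of _ =
    \<lparr>nl_carrier = UNIV, nl_zero = 0, nl_add = (+), nl_scale = (*\<^sub>R), nl_le = (\<le>),
     nl_join = sup, nl_meet = inf, nl_norm = norm\<rparr>"


section \<open>Ultrapowers\<close>

definition free_ultrafilter :: "nat filter \<Rightarrow> bool"
  where "free_ultrafilter U \<longleftrightarrow>
    U \<noteq> bot \<and> (\<forall>P. eventually P U \<or> eventually (\<lambda>n. \<not> P n) U) \<and>
    (\<forall>m. eventually (\<lambda>n. n \<noteq> m) U)"

text \<open>
  The space of bounded sequences is \<^typ>\<open>nat \<Rightarrow>\<^sub>C 'a\<close> with its supremum norm; as
  \<^typ>\<open>nat\<close> is discrete, continuity is no restriction.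
\<close>

definition seq_sup :: "(nat \<Rightarrow>\<^sub>C 'a::banach_lattice) \<Rightarrow> (nat \<Rightarrow>\<^sub>C 'a) \<Rightarrow> (nat \<Rightarrow>\<^sub>C 'a)"
  where "seq_sup x y = Bcontfun (\<lambda>n. sup (apply_bcontfun x n) (apply_bcontfun y n))"

lemma apply_seq_sup:
  "apply_bcontfun (seq_sup x y) n = sup (apply_bcontfun x n) (apply_bcontfun y n)"
proof -
  obtain a b where ab: "\<And>n. norm (apply_bcontfun x n) \<le> a" "\<And>n. norm (apply_bcontfun y n) \<le> b"
    by (meson norm_bounded)
  have "norm (sup (apply_bcontfun x n) (apply_bcontfun y n)) \<le> a + b" for n
    by (rule order_trans[OF norm_sup_le add_mono[OF ab]])
  then have "(\<lambda>n. sup (apply_bcontfun x n) (apply_bcontfun y n)) \<in> bcontfun"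
    unfolding bcontfun_def bounded_iff by auto
  then show ?thesis
    by (simp add: seq_sup_def Bcontfun_inverse)
qed

definition seq_inf :: "(nat \<Rightarrow>\<^sub>C 'a::banach_lattice) \<Rightarrow> (nat \<Rightarrow>\<^sub>C 'a) \<Rightarrow> (nat \<Rightarrow>\<^sub>C 'a)"
  where "seq_inf x y = Bcontfun (\<lambda>n. inf (apply_bcontfun x n) (apply_bcontfun y n))"

lemma apply_seq_inf:
  "apply_bcontfun (seq_inf x y) n = inf (apply_bcontfun x n) (apply_bcontfun y n)"
proof -
  obtain a b where ab: "\<And>n. norm (apply_bcontfun x n) \<le> a" "\<And>n. norm (apply_bcontfun y n) \<le> b"
    by (meson norm_bounded)
  have "norm (inf (apply_bcontfun x n) (apply_bcontfun y n)) \<le> a + b" for n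
    by (rule order_trans[OF norm_inf_le add_mono[OF ab]])
  then have "(\<lambda>n. inf (apply_bcontfun x n) (apply_bcontfun y n)) \<in> bcontfun"
    unfolding bcontfun_def bounded_iff by auto
  then show ?thesis
    by (simp add: seq_inf_def Bcontfun_inverse)
qed

definition c0U :: "nat filter \<Rightarrow> (nat \<Rightarrow>\<^sub>C 'a::banach_lattice) set"
  where "c0U U = {x. ((\<lambda>n. norm (apply_bcontfun x n)) \<longlongrightarrow> 0) U}"

definition ultra_rel :: "nat filter \<Rightarrow> ((nat \<Rightarrow>\<^sub>C 'a::banach_lattice) \<times> (nat \<Rightarrow>\<^sub>C 'a)) set"
  where "ultra_rel U = {(x, y). x - y \<in> c0U U}"

text \<open>
  The elements of the ultrapower are the cosets of \<open>c0U\<close>, its operations are computed on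
  representatives, and its norm is the quotient norm.  The order is the one determined by the
  lattice operations.
\<close>

definition ultra_op2 ::
  "nat filter \<Rightarrow> ((nat \<Rightarrow>\<^sub>C 'a) \<Rightarrow> (nat \<Rightarrow>\<^sub>C 'a) \<Rightarrow> (nat \<Rightarrow>\<^sub>C 'a)) \<Rightarrow>
   (nat \<Rightarrow>\<^sub>C 'a::banach_lattice) set \<Rightarrow> (nat \<Rightarrow>\<^sub>C 'a) set \<Rightarrow> (nat \<Rightarrow>\<^sub>C 'a) set"
  where "ultra_op2 U f C D = (\<Union>x\<in>C. \<Union>y\<in>D. ultra_rel U `` {f x y})"

definition ultrapower :: "nat filter \<Rightarrow> 'a::banach_lattice itself \<Rightarrow> (nat \<Rightarrow>\<^sub>C 'a) set normed_lattice"
  where "ultrapower U _ =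
    \<lparr>nl_carrier = UNIV // ultra_rel U,
     nl_zero = ultra_rel U `` {0},
     nl_add = ultra_op2 U (+),
     nl_scale = (\<lambda>c C. \<Union>x\<in>C. ultra_rel U `` {c *\<^sub>R x}),
     nl_le = (\<lambda>C D. ultra_op2 U seq_inf C D = C),
     nl_join = ultra_op2 U seq_sup,
     nl_meet = ultra_op2 U seq_inf,
     nl_norm = (\<lambda>C. Inf (norm ` C))\<rparr>"

lemma c0U_0: "0 \<in> c0U U"
  by (simp add: c0U_def)

lemma c0U_bound:
  assumes "y \<in> c0U U" "z \<in> c0U U"
    and "\<And>n. norm (apply_bcontfun x n) \<le> norm (apply_bcontfun y n) + norm (apply_bcontfun z n)"
  shows "x \<in> c0U U"
proof -
  have "((\<lambda>n. norm (apply_bcontfun y n) + norm (apply_bcontfun z n)) \<longlongrightarrow> 0) U"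
    using tendsto_add[of "\<lambda>n. norm (apply_bcontfun y n)" 0 U "\<lambda>n. norm (apply_bcontfun z n)" 0]
      assms(1,2) by (simp add: c0U_def)
  then show ?thesis
    unfolding c0U_def mem_Collect_eq
    by (rule Lim_null_comparison[rotated]) (simp add: assms(3))
qed

lemma c0U_scale: "x \<in> c0U U \<Longrightarrow> c *\<^sub>R x \<in> c0U U"
  using tendsto_mult_right_zero[of "\<lambda>n. norm (apply_bcontfun x n)" U "\<bar>c\<bar>"]
  by (simp add: c0U_def)

lemma equiv_ultra_rel:
  "equiv UNIV (ultra_rel U :: ((nat \<Rightarrow>\<^sub>C 'a::banach_lattice) \<times> (nat \<Rightarrow>\<^sub>C 'a)) set)"
proof (rule equivI)
  show "refl (ultra_rel U :: ((nat \<Rightarrow>\<^sub>C 'a) \<times> (nat \<Rightarrow>\<^sub>C 'a)) set)"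
    by (auto simp: refl_on_def ultra_rel_def c0U_0)
  show "sym (ultra_rel U :: ((nat \<Rightarrow>\<^sub>C 'a) \<times> (nat \<Rightarrow>\<^sub>C 'a)) set)"
    unfolding sym_def ultra_rel_def using c0U_scale[of _ U "-1"] by fastforce
  show "trans (ultra_rel U :: ((nat \<Rightarrow>\<^sub>C 'a) \<times> (nat \<Rightarrow>\<^sub>C 'a)) set)"
  proof (rule transI)
    fix x y z :: "nat \<Rightarrow>\<^sub>C 'a"
    assume "(x, y) \<in> ultra_rel U" "(y, z) \<in> ultra_rel U"
    then have "x - y \<in> c0U U" "y - z \<in> c0U U"
      by (simp_all add: ultra_rel_def)
    moreover have "norm (apply_bcontfun (x - z) n) \<le>
        norm (apply_bcontfun (x - y) n) + norm (apply_bcontfun (y - z) n)" for n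
      using norm_triangle_ineq[of "apply_bcontfun (x - y) n" "apply_bcontfun (y - z) n"]
      by simp
    ultimately have "x - z \<in> c0U U" by (rule c0U_bound)
    then show "(x, z) \<in> ultra_rel U" by (simp add: ultra_rel_def)
  qed
qed auto

lemma ultra_op2_class:
  assumes f: "\<And>x y x' y' n. norm (apply_bcontfun (f x y - f x' y') n) \<le>
      norm (apply_bcontfun (x - x') n) + norm (apply_bcontfun (y - y') n)"
  shows "ultra_op2 U f (ultra_rel U `` {x}) (ultra_rel U `` {y}) = ultra_rel U `` {f x y}"
proof -
  have "congruent2 (ultra_rel U) (ultra_rel U) (\<lambda>x y. ultra_rel U `` {f x y})"
  proof (rule congruent2I')
    fix x x' y y' :: "nat \<Rightarrow>\<^sub>C 'a"
    assume "(x, x') \<in> ultra_rel U" "(y, y') \<in> ultra_rel U"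
    then have "(f x y, f x' y') \<in> ultra_rel U"
      unfolding ultra_rel_def mem_Collect_eq case_prod_conv
      by (rule c0U_bound) (rule f)
    then show "ultra_rel U `` {f x y} = ultra_rel U `` {f x' y'}"
      by (rule equiv_class_eq[OF equiv_ultra_rel])
  qed
  then show ?thesis
    unfolding ultra_op2_def
    by (rule UN_equiv_class2[OF equiv_ultra_rel equiv_ultra_rel]) auto
qed

lemma ultra_ops_class:
  fixes U :: "nat filter" and x y :: "nat \<Rightarrow>\<^sub>C 'a::banach_lattice"
  defines "L \<equiv> ultrapower U TYPE('a)" and "c \<equiv> \<lambda>x. ultra_rel U `` {x}"
  shows "nl_add L (c x) (c y) = c (x + y)"
    and "nl_join L (c x) (c y) = c (seq_sup x y)"
    and "nl_meet L (c x) (c y) = c (seq_inf x y)"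
    and "nl_scale L r (c x) = c (r *\<^sub>R x)"
proof -
  show "nl_add L (c x) (c y) = c (x + y)"
    unfolding L_def ultrapower_def c_def normed_lattice.simps
    by (rule ultra_op2_class) (simp add: add_diff_add norm_triangle_ineq)
  show "nl_join L (c x) (c y) = c (seq_sup x y)"
    unfolding L_def ultrapower_def c_def normed_lattice.simps
    by (rule ultra_op2_class) (simp only: minus_bcontfun.rep_eq apply_seq_sup norm_sup_diff_le)
  show "nl_meet L (c x) (c y) = c (seq_inf x y)"
    unfolding L_def ultrapower_def c_def normed_lattice.simps
    by (rule ultra_op2_class) (simp only: minus_bcontfun.rep_eq apply_seq_inf norm_inf_diff_le)
  have "congruent (ultra_rel U) (\<lambda>x :: nat \<Rightarrow>\<^sub>C 'a. ultra_rel U `` {r *\<^sub>R x})"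
  proof (rule congruentI)
    fix x y :: "nat \<Rightarrow>\<^sub>C 'a"
    assume "(x, y) \<in> ultra_rel U"
    then have "(r *\<^sub>R x, r *\<^sub>R y) \<in> ultra_rel U"
      using c0U_scale[of "x - y" U r] by (simp add: ultra_rel_def scaleR_diff_right)
    then show "ultra_rel U `` {r *\<^sub>R x} = ultra_rel U `` {r *\<^sub>R y}"
      by (rule equiv_class_eq[OF equiv_ultra_rel])
  qed
  then show "nl_scale L r (c x) = c (r *\<^sub>R x)"
    unfolding L_def ultrapower_def c_def normed_lattice.simps
    by (rule UN_equiv_class[OF equiv_ultra_rel]) simp
qed

lemma bounded_seq_tendsto_Lim:
  fixes a :: "nat \<Rightarrow> real"
  assumes U: "free_ultrafilter U" and a: "\<And>n. a n \<in> {b..c}"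
  shows "(a \<longlongrightarrow> Lim U a) U"
proof -
  have U': "U \<noteq> bot" "\<And>P. eventually P U \<or> eventually (\<lambda>n. \<not> P n) U"
    using U by (auto simp: free_ultrafilter_def)
  have "\<exists>l\<in>{b..c}. inf (nhds l) (filtermap a U) \<noteq> bot"
    using compact_Icc[of b c] U'(1) a unfolding compact_filter
    by (simp add: filtermap_bot_iff eventually_filtermap)
  then obtain l where l: "inf (nhds l) (filtermap a U) \<noteq> bot" by blast
  have "(a \<longlongrightarrow> l) U"
  proof (rule topological_tendstoI)
    fix S assume S: "open S" "l \<in> S"
    have False if "eventually (\<lambda>n. a n \<notin> S) U"
    proof -
      have "eventually (\<lambda>x. x \<in> S) (nhds l)" using S by (rule eventually_nhds_in_open)
      moreover have "eventually (\<lambda>x. x \<notin> S) (filtermap a U)"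
        using that by (simp add: eventually_filtermap)
      ultimately have "eventually (\<lambda>x. False) (inf (nhds l) (filtermap a U))"
        by (auto simp: eventually_inf)
      then show False using l by (simp add: trivial_limit_def)
    qed
    then show "eventually (\<lambda>n. a n \<in> S) U" using U'(2)[of "\<lambda>n. a n \<in> S"] by blast
  qed
  then show ?thesis using tendsto_Lim[OF U'(1)] by metis
qed

lemma ultra_norm_class:
  fixes U :: "nat filter" and x :: "nat \<Rightarrow>\<^sub>C 'a::banach_lattice"
  assumes U: "free_ultrafilter U"
  shows "nl_norm (ultrapower U TYPE('a)) (ultra_rel U `` {x}) =
    Lim U (\<lambda>n. norm (apply_bcontfun x n))"
proof -
  have bot: "U \<noteq> bot" using U by (auto simp: free_ultrafilter_def)
  define N where "N = Lim U (\<lambda>n. norm (apply_bcontfun x n))"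
  have xN: "((\<lambda>n. norm (apply_bcontfun x n)) \<longlongrightarrow> N) U"
    unfolding N_def by (rule bounded_seq_tendsto_Lim[OF U, of _ 0 "norm x"]) (simp add: norm_bounded)
  have xC: "x \<in> ultra_rel U `` {x}" by (simp add: ultra_rel_def c0U_0)
  have le: "N \<le> norm y" if "y \<in> ultra_rel U `` {x}" for y
  proof -
    have "((\<lambda>n. norm (apply_bcontfun (x - y) n)) \<longlongrightarrow> 0) U"
      using that by (simp add: ultra_rel_def c0U_def)
    then have "((\<lambda>n. norm (apply_bcontfun (x - y) n) + norm y) \<longlongrightarrow> 0 + norm y) U"
      by (intro tendsto_add tendsto_const)
    moreover have "norm (apply_bcontfun x n) \<le> norm (apply_bcontfun (x - y) n) + norm y" for n
      using norm_triangle_ineq[of "apply_bcontfun (x - y) n" "apply_bcontfun y n"] norm_bounded[of y n]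
      by simp
    ultimately have "N \<le> 0 + norm y"
      using tendsto_le[OF bot _ xN] by (simp add: always_eventually)
    then show ?thesis by simp
  qed
  have "Inf (norm ` (ultra_rel U `` {x})) = N"
  proof (rule antisym)
    show "N \<le> Inf (norm ` (ultra_rel U `` {x}))"
      using xC le by (intro cINF_greatest) auto
    show "Inf (norm ` (ultra_rel U `` {x})) \<le> N"
    proof (rule field_le_epsilon)
      fix e :: real assume e: "0 < e"
      define y where
        "y = Bcontfun (\<lambda>n. if norm (apply_bcontfun x n) < N + e then apply_bcontfun x n else 0)"
      have N0: "0 \<le> N"
        by (rule tendsto_lowerbound[OF xN _ bot]) simp
      have "(\<lambda>n. if norm (apply_bcontfun x n) < N + e then apply_bcontfun x n else 0) \<in> bcontfun"
        unfolding bcontfun_def bounded_iff using e N0 by (auto intro!: exI[of _ "N + e"])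
      then have y: "apply_bcontfun y n =
          (if norm (apply_bcontfun x n) < N + e then apply_bcontfun x n else 0)" for n
        by (simp add: y_def Bcontfun_inverse)
      have "eventually (\<lambda>n. norm (apply_bcontfun x n) < N + e) U"
        using xN e by (intro order_tendstoD(2)[OF xN]) simp
      then have "eventually (\<lambda>n. norm (apply_bcontfun (x - y) n) = 0) U"
        by eventually_elim (simp add: y)
      then have "y \<in> ultra_rel U `` {x}"
        by (simp add: ultra_rel_def c0U_def tendsto_eventually)
      then have "Inf (norm ` (ultra_rel U `` {x})) \<le> norm y"
        using le by (intro cINF_lower bdd_belowI[of _ N]) auto
      also have "norm y \<le> N + e"
        using e N0 by (intro norm_bound) (auto simp: y)
      finally show "Inf (norm ` (ultra_rel U `` {x})) \<le> N + e" .
    qed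
  qed
  then show ?thesis by (simp add: ultrapower_def N_def)
qed

end

theory Submission
  imports Defs
begin

text \<open>
  For positive \<open>x\<close> and \<open>y\<close> one has \<open>\<bar>x - y\<bar> \<le> x + y\<close>, so the maximum defining the lattice Schaeffer
  constant is \<open>norm (x + y)\<close>; for disjoint \<open>x\<close> and \<open>y\<close> one has \<open>sup x y = x + y\<close>.  Both constants
  are therefore infima of \<open>norm (x + y)\<close> over positive unit vectors, taken over disjoint pairs in
  the case of \<open>beta_const\<close>.  Comparing two lattices needs two things: an embedding of the space
  that keeps norms, sums, positivity and disjointness, and conversely, for every pair in the larger
  lattice, a pair in the space whose norms are almost as large and whose sum is almost as small
  (\<open>lattice_schaffer_eqI\<close>, \<open>beta_const_eqI\<close>).

  In the ultrapower the embedding is by constant sequences, and a pair of classes is approximated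
  by the entries of representatives at one suitable index.

  The canonical embedding into the bidual is isometric by the Hahn--Banach theorem.  Applied to the
  sublinear functional \<open>z \<mapsto> f (pprt z)\<close>, the same theorem splits a positive functional along a
  disjoint pair, and so disjointness survives (\<open>bidual_embedding_disjoint\<close>).  Conversely, given a
  positive pair \<open>F, G\<close> in the bidual and functionals that almost norm it, separation in the plane
  reduces the search for a pair in the space to a comparison of support functions.  Without
  disjointness the relevant support function is given by the Riesz--Kantorovich formula
  (\<open>Goldstine_nonneg_pair\<close>).  In the disjoint case \<open>F\<close> and \<open>G\<close> are the positive and the negative part
  of \<open>F - G\<close>; by Goldstine's argument for two functionals a single vector \<open>z\<close> approximates \<open>F - G\<close>
  (\<open>Goldstine_pair\<close>), and its positive and negative parts are the required pair.
\<close>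

section \<open>Linear functionals below a sublinear one\<close>

definition sublinear :: "('v::real_vector \<Rightarrow> real) \<Rightarrow> bool"
  where "sublinear p \<longleftrightarrow>
    (\<forall>x y. p (x + y) \<le> p x + p y) \<and> (\<forall>c\<ge>0. \<forall>x. p (c *\<^sub>R x) = c * p x)"

lemma sublinearI:
  assumes add: "\<And>x y. p (x + y) \<le> p x + p y"
    and scale: "\<And>c x. 0 < c \<Longrightarrow> p (c *\<^sub>R x) \<le> c * p x" and zero: "p 0 \<le> 0"
  shows "sublinear p"
  unfolding sublinear_def
proof (intro conjI allI impI add)
  fix c :: real and x
  assume "0 \<le> c"
  then consider "c = 0" | "0 < c" by linarith
  then show "p (c *\<^sub>R x) = c * p x"
  proof cases
    case 1
    then show ?thesis using add[of 0 0] zero by simp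
  next
    case 2
    have "p (inverse c *\<^sub>R (c *\<^sub>R x)) \<le> inverse c * p (c *\<^sub>R x)"
      using 2 by (intro scale) simp
    then have "c * p x \<le> p (c *\<^sub>R x)" using 2 by (simp add: field_simps)
    then show ?thesis using scale[OF 2, of x] by simp
  qed
qed

lemma sublinear_add: "sublinear p \<Longrightarrow> p (x + y) \<le> p x + p y"
  and sublinear_scale: "sublinear p \<Longrightarrow> 0 \<le> c \<Longrightarrow> p (c *\<^sub>R x) = c * p x"
  by (simp_all add: sublinear_def)

lemma sublinear_zero: "sublinear p \<Longrightarrow> p 0 = 0"
  using sublinear_scale[of p 0 0] by simp

lemma sublinear_neg_le: "sublinear p \<Longrightarrow> - p (- x) \<le> p x"
  using sublinear_add[of p x "- x"] by (simp add: sublinear_zero)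

text \<open>
  A linear \<open>g \<le> p\<close> with \<open>g y = p y\<close> also lies below \<open>x \<mapsto> p (x + t y) - t p y\<close> for every
  \<open>t \<ge> 0\<close>.  The infimum over \<open>t\<close> is still sublinear, and \<open>t = 1\<close> shows that it is already
  linear along \<open>y\<close>.
\<close>

lemma sublinear_tighten:
  fixes p :: "'v::real_vector \<Rightarrow> real"
  assumes p: "sublinear p"
  obtains q where "sublinear q" "\<And>x. q x \<le> p x" "q (- y) \<le> - p y"
proof
  define q where "q x = (INF t\<in>{0..}. p (x + t *\<^sub>R y) - t * p y)" for x
  have low: "- p (- x) \<le> p (x + t *\<^sub>R y) - t * p y" if "0 \<le> t" for x t
    using sublinear_add[OF p, of "x + t *\<^sub>R y" "- x"] sublinear_scale[OF p that, of y] by simp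
  have q_le: "q x \<le> p (x + t *\<^sub>R y) - t * p y" if "0 \<le> t" for x t
    unfolding q_def using that
    by (intro cINF_lower bdd_belowI[of _ "- p (- x)"]) (auto intro: low)
  have le_q: "b \<le> q x" if "\<And>t. 0 \<le> t \<Longrightarrow> b \<le> p (x + t *\<^sub>R y) - t * p y" for b x
    unfolding q_def using that by (intro cINF_greatest) auto
  show q_p: "q x \<le> p x" for x using q_le[of 0 x] by simp
  show "q (- y) \<le> - p y" using q_le[of 1 "- y"] by (simp add: sublinear_zero[OF p])
  show "sublinear q"
  proof (rule sublinearI)
    fix x z
    have "q (x + z) - q x \<le> q z"
    proof (rule le_q)
      fix t :: real assume t: "0 \<le> t"
      have "q (x + z) - (p (z + t *\<^sub>R y) - t * p y) \<le> q x"
      proof (rule le_q)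
        fix s :: real assume s: "0 \<le> s"
        have "q (x + z) \<le> p ((x + z) + (s + t) *\<^sub>R y) - (s + t) * p y"
          using s t by (intro q_le) simp
        moreover have "p ((x + z) + (s + t) *\<^sub>R y) \<le> p (x + s *\<^sub>R y) + p (z + t *\<^sub>R y)"
          using sublinear_add[OF p, of "x + s *\<^sub>R y" "z + t *\<^sub>R y"] by (simp add: algebra_simps)
        ultimately show "q (x + z) - (p (z + t *\<^sub>R y) - t * p y) \<le> p (x + s *\<^sub>R y) - s * p y"
          by (simp add: algebra_simps)
      qed
      then show "q (x + z) - q x \<le> p (z + t *\<^sub>R y) - t * p y" by simp
    qed
    then show "q (x + z) \<le> q x + q z" by simp
  next
    fix c :: real and x assume c: "0 < c"
    have "inverse c * q (c *\<^sub>R x) \<le> q x"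
    proof (rule le_q)
      fix t :: real assume t: "0 \<le> t"
      have "q (c *\<^sub>R x) \<le> p (c *\<^sub>R x + (c * t) *\<^sub>R y) - (c * t) * p y"
        using c t by (intro q_le) simp
      also have "p (c *\<^sub>R x + (c * t) *\<^sub>R y) = c * p (x + t *\<^sub>R y)"
        using sublinear_scale[OF p, of c "x + t *\<^sub>R y"] c by (simp add: scaleR_add_right)
      finally show "inverse c * q (c *\<^sub>R x) \<le> p (x + t *\<^sub>R y) - t * p y"
        using c by (simp add: field_simps)
    qed
    then show "q (c *\<^sub>R x) \<le> c * q x" using c by (simp add: field_simps)
  next
    show "q 0 \<le> 0" using q_p[of 0] by (simp add: sublinear_zero[OF p])
  qed
qed

lemma chain_Inf_sublinear:
  fixes C :: "('v::real_vector \<Rightarrow> real) set"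
  assumes ne: "C \<noteq> {}" and sub: "\<And>q. q \<in> C \<Longrightarrow> sublinear q"
    and chain: "\<And>q r. q \<in> C \<Longrightarrow> r \<in> C \<Longrightarrow> q \<le> r \<or> r \<le> q"
    and bdd: "\<And>x. bdd_below ((\<lambda>q. q x) ` C)"
  shows "sublinear (\<lambda>x. INF q\<in>C. q x)"
proof (rule sublinearI)
  fix x y
  have low: "(INF q\<in>C. q z) \<le> q z" if "q \<in> C" for q z
    using that by (intro cINF_lower bdd)
  have pair: "(INF q\<in>C. q (x + y)) \<le> q x + r y" if q: "q \<in> C" and r: "r \<in> C" for q r
  proof -
    \<comment> \<open>the smaller of two comparable functionals bounds both terms\<close>
    obtain s where s: "s \<in> C" "s \<le> q" "s \<le> r" using chain[OF q r] q r by blast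
    have "(INF q\<in>C. q (x + y)) \<le> s (x + y)" by (rule low[OF s(1)])
    also have "\<dots> \<le> s x + s y" by (rule sublinear_add[OF sub[OF s(1)]])
    also have "\<dots> \<le> q x + r y" using s by (intro add_mono) (auto simp: le_fun_def)
    finally show ?thesis .
  qed
  have "(INF q\<in>C. q (x + y)) - (INF q\<in>C. q x) \<le> (INF r\<in>C. r y)"
  proof (rule cINF_greatest[OF ne])
    fix r assume r: "r \<in> C"
    have "(INF q\<in>C. q (x + y)) - r y \<le> (INF q\<in>C. q x)"
      by (rule cINF_greatest[OF ne]) (use pair[OF _ r] in \<open>simp add: algebra_simps\<close>)
    then show "(INF q\<in>C. q (x + y)) - (INF q\<in>C. q x) \<le> r y" by simp
  qed
  then show "(INF q\<in>C. q (x + y)) \<le> (INF q\<in>C. q x) + (INF q\<in>C. q y)" by simp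
next
  fix c :: real and x assume c: "0 < c"
  have "inverse c * (INF q\<in>C. q (c *\<^sub>R x)) \<le> (INF q\<in>C. q x)"
  proof (rule cINF_greatest[OF ne])
    fix q assume q: "q \<in> C"
    have "(INF q\<in>C. q (c *\<^sub>R x)) \<le> q (c *\<^sub>R x)" using q by (intro cINF_lower bdd)
    also have "\<dots> = c * q x" using c by (intro sublinear_scale sub q) simp
    finally show "inverse c * (INF q\<in>C. q (c *\<^sub>R x)) \<le> q x" using c by (simp add: field_simps)
  qed
  then show "(INF q\<in>C. q (c *\<^sub>R x)) \<le> c * (INF q\<in>C. q x)" using c by (simp add: field_simps)
next
  obtain q where q: "q \<in> C" using ne by blast
  have "(INF q\<in>C. q 0) \<le> q 0" using q by (intro cINF_lower bdd)
  then show "(INF q\<in>C. q 0) \<le> 0" by (simp add: sublinear_zero[OF sub[OF q]])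
qed

text \<open>
  A minimal sublinear functional is linear, because tightening it along any \<open>y\<close> cannot change it
  and so makes it odd.  Zorn's lemma provides a minimal one below \<open>p\<close>.
\<close>

lemma linear_below_sublinear:
  fixes p :: "'v::real_vector \<Rightarrow> real"
  assumes p: "sublinear p"
  obtains g where "linear g" "\<And>x. g x \<le> p x"
proof -
  define A where "A = {q. sublinear q \<and> q \<le> p}"
  define P :: "('v \<Rightarrow> real) \<Rightarrow> ('v \<Rightarrow> real) \<Rightarrow> bool" where "P q r \<longleftrightarrow> r \<le> q" for q r
  have "\<exists>m\<in>A. \<forall>a\<in>A. P m a \<longrightarrow> a = m"
  proof (rule predicate_Zorn)
    show "partial_order_on A (relation_of P A)"
      by (rule partial_order_on_relation_ofI) (auto simp: P_def)
    fix C assume "C \<in> Chains (relation_of P A)"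
    then have CA: "C \<subseteq> A" and chain: "\<And>q r. q \<in> C \<Longrightarrow> r \<in> C \<Longrightarrow> q \<le> r \<or> r \<le> q"
      by (auto simp: Chains_def relation_of_def P_def)
    show "\<exists>u\<in>A. \<forall>a\<in>C. P a u"
    proof (cases "C = {}")
      case True
      then show ?thesis using p by (auto simp: A_def)
    next
      case False
      have sub: "sublinear q" and le: "q x \<le> p x" if "q \<in> C" for q x
        using that CA by (auto simp: A_def le_fun_def)
      have bdd: "bdd_below ((\<lambda>q. q x) ` C)" for x
      proof (rule bdd_belowI2)
        fix q assume q: "q \<in> C"
        show "- p (- x) \<le> q x"
          using sublinear_neg_le[OF sub[OF q], of x] le[OF q, of "- x"] by simp
      qed
      define u where "u x = (INF q\<in>C. q x)" for x
      have below: "u \<le> q" if "q \<in> C" for q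
        unfolding u_def le_fun_def using that by (auto intro: cINF_lower bdd)
      have "u \<le> p"
        using False below le by (fastforce simp: le_fun_def intro: order_trans)
      moreover have "sublinear u"
        unfolding u_def by (intro chain_Inf_sublinear False sub chain bdd)
      ultimately show ?thesis using below by (auto simp: A_def P_def)
    qed
  qed
  then obtain m where m: "sublinear m" "m \<le> p"
    and min: "\<And>q. sublinear q \<Longrightarrow> q \<le> p \<Longrightarrow> q \<le> m \<Longrightarrow> q = m"
    by (auto simp: A_def P_def)
  have odd: "m (- y) = - m y" for y
  proof -
    obtain q where q: "sublinear q" "\<And>x. q x \<le> m x" "q (- y) \<le> - m y"
      using sublinear_tighten[OF m(1), where y = y] by blast
    then have "q \<le> m" by (simp add: le_fun_def)
    then have "q = m" using min q(1) m(2) by (meson order_trans)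
    then show ?thesis using q(3) sublinear_neg_le[OF m(1), of y] by simp
  qed
  have "linear m"
  proof (rule linearI)
    fix x y
    have "m x \<le> m (x + y) + m (- y)" using sublinear_add[OF m(1), of "x + y" "- y"] by simp
    then show "m (x + y) = m x + m y" using sublinear_add[OF m(1), of x y] by (simp add: odd)
  next
    fix c x
    show "m (c *\<^sub>R x) = c *\<^sub>R m x"
    proof (cases "0 \<le> c")
      case True
      then show ?thesis by (simp add: sublinear_scale[OF m(1)])
    next
      case False
      then have "m (- (c *\<^sub>R x)) = - c * m x"
        using sublinear_scale[OF m(1), of "- c" x] by simp
      then show ?thesis by (simp add: odd)
    qed
  qed
  then show thesis using that m(2) by (auto simp: le_fun_def)
qed

lemma Hahn_Banach_at_point:
  fixes p :: "'v::real_vector \<Rightarrow> real"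
  assumes p: "sublinear p"
  obtains g where "linear g" "\<And>x. g x \<le> p x" "g z = p z"
proof -
  obtain q where q: "sublinear q" "\<And>x. q x \<le> p x" "q (- z) \<le> - p z"
    using sublinear_tighten[OF p, where y = z] by blast
  obtain g where g: "linear g" "\<And>x. g x \<le> q x" using linear_below_sublinear[OF q(1)] by blast
  have "g x \<le> p x" for x using g(2) q(2) order_trans by blast
  moreover have "p z \<le> g z"
    using g(2)[of "- z"] q(3) linear_neg[OF g(1), of z] by simp
  ultimately show thesis using that g(1) by (meson antisym)
qed

section \<open>Disjointness under the canonical embedding into the bidual\<close>

lemma dual_apply_mono:
  fixes f :: "'a::banach_lattice dual_space"
  assumes "0 \<le> f" "x \<le> y"
  shows "dual_apply f x \<le> dual_apply f y"
proof -
  have "0 \<le> y - x" using assms(2) by simp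
  then have "dual_apply 0 (y - x) \<le> dual_apply f (y - x)"
    using assms(1) unfolding less_eq_dual_space_def by blast
  then show ?thesis by simp
qed

lemma dual_apply_le_norm: "norm f \<le> 1 \<Longrightarrow> dual_apply f x \<le> norm x"
  using norm_dual_apply_le[of f x] mult_right_mono[of "norm f" 1 "norm x"] by simp

lemma dual_space_of_linear:
  assumes "linear g" "\<And>x. g x \<le> norm x * b"
  obtains f :: "'a::real_normed_vector dual_space" where "\<And>x. dual_apply f x = g x"
proof
  have "bounded_linear g"
  proof (rule bounded_linear_intro[of _ b])
    show "norm (g x) \<le> norm x * b" for x
      using assms(2)[of x] assms(2)[of "- x"] linear_neg[OF assms(1), of x] by (simp add: abs_le_iff)
  qed (simp_all add: linear_add[OF assms(1)] linear_cmul[OF assms(1)])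
  then show "dual_apply (dual_of_blinfun (Blinfun g)) x = g x" for x
    by (simp add: dual_apply.rep_eq dual_of_blinfun_inverse bounded_linear_Blinfun_apply)
qed

lemma norming_functional:
  fixes x :: "'a::real_normed_vector"
  obtains f :: "'a dual_space" where "norm f \<le> 1" "dual_apply f x = norm x"
proof -
  have "sublinear (norm :: 'a \<Rightarrow> real)"
    by (simp add: sublinear_def norm_triangle_ineq)
  then obtain g :: "'a \<Rightarrow> real" where g: "linear g" "\<And>y. g y \<le> norm y" "g x = norm x"
    using Hahn_Banach_at_point[of norm x] by blast
  obtain f :: "'a dual_space" where f: "\<And>y. dual_apply f y = g y"
    using dual_space_of_linear[OF g(1), of 1] g(2) by auto
  have "\<bar>dual_apply f y\<bar> \<le> 1 * norm y" for y
    using g(2)[of y] g(2)[of "- y"] linear_neg[OF g(1), of y] by (simp add: f abs_le_iff)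
  then have "norm f \<le> 1" by (rule norm_dual_bound[rotated]) simp
  then show thesis using that g(3) f by simp
qed

text \<open>
  For positive \<open>f\<close> the functional \<open>x \<mapsto> f (pprt x)\<close> is sublinear.  A linear functional below it is
  nonpositive at \<open>- x\<close> and at most \<open>f x\<close> at \<open>x\<close> whenever \<open>x \<ge> 0\<close>, so it lies between \<open>0\<close> and \<open>f\<close>.
\<close>

lemma functional_on_positive_part:
  fixes f :: "'a::banach_lattice dual_space"
  assumes f: "0 \<le> f"
  obtains g where "0 \<le> g" "g \<le> f" "dual_apply g z = dual_apply f (pprt z)"
proof -
  have "sublinear (\<lambda>z. dual_apply f (pprt z))"
  proof (rule sublinearI)
    fix x y :: 'a
    have "x \<le> pprt x" "y \<le> pprt y" by (simp_all add: pprt_def)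
    then have "pprt (x + y) \<le> pprt x + pprt y"
      unfolding pprt_def[of "x + y"] by (intro le_supI add_mono add_nonneg_nonneg zero_le_pprt)
    from dual_apply_mono[OF f this]
    show "dual_apply f (pprt (x + y)) \<le> dual_apply f (pprt x) + dual_apply f (pprt y)" by simp
  next
    fix c :: real and x :: 'a assume c: "0 < c"
    have "x \<le> pprt x" by (simp add: pprt_def)
    then have "pprt (c *\<^sub>R x) \<le> c *\<^sub>R pprt x"
      unfolding pprt_def[of "c *\<^sub>R x"] using c
      by (intro le_supI scaleR_left_mono scaleR_nonneg_nonneg) auto
    from dual_apply_mono[OF f this]
    show "dual_apply f (pprt (c *\<^sub>R x)) \<le> c * dual_apply f (pprt x)" by simp
  qed simp
  then obtain h where h: "linear h" "\<And>x. h x \<le> dual_apply f (pprt x)" "h z = dual_apply f (pprt z)"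
    using Hahn_Banach_at_point[of "\<lambda>z. dual_apply f (pprt z)" z] by blast
  have "h x \<le> norm x * norm f" for x
  proof -
    have "norm (pprt x) \<le> norm x"
      by (rule norm_lattice_mono) (simp add: abs_prts[of x])
    then have "norm f * norm (pprt x) \<le> norm f * norm x" by (rule mult_left_mono) simp
    then show ?thesis
      using h(2)[of x] norm_dual_apply_le[of f "pprt x"] by (simp add: mult.commute[of "norm x"])
  qed
  then obtain g :: "'a dual_space" where g: "\<And>x. dual_apply g x = h x"
    using dual_space_of_linear[OF h(1)] by blast
  show thesis
  proof
    show "0 \<le> g"
      unfolding less_eq_dual_space_def
    proof (intro allI impI)
      fix x :: 'a assume "0 \<le> x"
      then show "dual_apply 0 x \<le> dual_apply g x"
        using h(2)[of "- x"] linear_neg[OF h(1), of x] by (simp add: g)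
    qed
    show "g \<le> f"
      unfolding less_eq_dual_space_def
    proof (intro allI impI)
      fix x :: 'a assume "0 \<le> x"
      then show "dual_apply g x \<le> dual_apply f x" using h(2)[of x] by (simp add: g)
    qed
    show "dual_apply g z = dual_apply f (pprt z)" by (simp add: g h(3))
  qed
qed

definition bidual_embedding :: "'a::real_normed_vector \<Rightarrow> 'a bidual"
  where "bidual_embedding x = (SOME F. \<forall>f. dual_apply F f = dual_apply f x)"

lemma dual_apply_bidual_embedding [simp]: "dual_apply (bidual_embedding x) f = dual_apply f x"
proof -
  have "linear (\<lambda>f :: 'a dual_space. dual_apply f x)" by (rule linearI) simp_all
  moreover have "dual_apply f x \<le> norm f * norm x" for f :: "'a dual_space"
    using norm_dual_apply_le[of f x] by simp
  ultimately obtain F :: "'a bidual" where "\<And>f. dual_apply F f = dual_apply f x"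
    using dual_space_of_linear by blast
  then have "\<exists>F :: 'a bidual. \<forall>f. dual_apply F f = dual_apply f x" by blast
  from someI_ex[OF this] show ?thesis unfolding bidual_embedding_def by blast
qed

lemma bidual_embedding_add: "bidual_embedding (x + y) = bidual_embedding x + bidual_embedding y"
  by (rule dual_space_eqI) simp

lemma norm_bidual_embedding: "norm (bidual_embedding x) = norm x"
proof (rule antisym)
  show "norm (bidual_embedding x) \<le> norm x"
    using norm_dual_apply_le[of _ x] by (intro norm_dual_bound) (simp_all add: mult.commute)
  obtain f :: "'a dual_space" where f: "norm f \<le> 1" "dual_apply f x = norm x"
    using norming_functional .
  have "norm x \<le> norm (bidual_embedding x) * norm f"
    using norm_dual_apply_le[of "bidual_embedding x" f] f(2) by simp
  also have "\<dots> \<le> norm (bidual_embedding x) * 1" using f(1) by (intro mult_left_mono) auto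
  finally show "norm x \<le> norm (bidual_embedding x)" by simp
qed

lemma bidual_embedding_nonneg: "0 \<le> x \<Longrightarrow> 0 \<le> bidual_embedding x"
  for x :: "'a::banach_lattice"
  unfolding less_eq_dual_space_def[of 0 "bidual_embedding x"]
  by (auto dest: dual_apply_mono[of _ 0 x])

lemma pprt_diff: "pprt (x - y) = x - inf x y"
  for x y :: "'a::banach_lattice"
proof -
  have "pprt (x - y) + y = sup x y"
    using add_sup_distrib_right[of "x - y" 0 y] by (simp add: pprt_def)
  then have "pprt (x - y) + y = x + y - inf x y"
    unfolding add_eq_inf_sup[of x y] by (simp only: add_diff_cancel_right')
  then show ?thesis by (metis add_diff_cancel_right' diff_add_eq diff_diff_add diff_diff_eq2)
qed

text \<open>
  If \<open>x\<close> and \<open>y\<close> are disjoint then \<open>x\<close> is the positive part of \<open>x - y\<close>.  So a positive \<open>f\<close> splits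
  as \<open>g + (f - g)\<close>, where \<open>g\<close> has the full value \<open>f x\<close> at \<open>x\<close> and vanishes at \<open>y\<close>; any
  \<open>K\<close> below both images then satisfies \<open>K f \<le> (f - g) x + g y = 0\<close>.
\<close>

lemma bidual_embedding_disjoint:
  fixes x y :: "'a::banach_lattice"
  assumes nonneg: "0 \<le> x" "0 \<le> y" and disj: "inf x y = 0"
  shows "inf (bidual_embedding x) (bidual_embedding y) = 0"
proof (rule dual_inf_eq)
  fix K assume K: "K \<le> bidual_embedding x" "K \<le> bidual_embedding y"
  have part: "pprt (x - y) = x"
    using pprt_diff[of x y] disj by simp
  show "K \<le> 0"
    unfolding less_eq_dual_space_def[of K 0]
  proof (intro allI impI)
    fix f :: "'a dual_space" assume "0 \<le> f"
    then obtain g where g: "0 \<le> g" "g \<le> f" "dual_apply g (x - y) = dual_apply f x"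
      using functional_on_positive_part[of f "x - y"] part by metis
    have "dual_apply g x \<le> dual_apply f x"
      using g(2) nonneg(1) unfolding less_eq_dual_space_def by blast
    moreover have "0 \<le> dual_apply g y" using dual_apply_mono[OF g(1) nonneg(2)] by simp
    ultimately have val: "dual_apply g x = dual_apply f x" "dual_apply g y = 0"
      using g(3) by simp_all
    have "0 \<le> f - g" using g(2) by simp
    then have "dual_apply K (f - g) \<le> dual_apply (bidual_embedding x) (f - g)"
      using K(1) unfolding less_eq_dual_space_def[of K] by blast
    moreover have "dual_apply K g \<le> dual_apply (bidual_embedding y) g"
      using K(2) g(1) unfolding less_eq_dual_space_def[of K] by blast
    ultimately show "dual_apply K f \<le> dual_apply 0 f" using val by simp
  qed
qed (use nonneg in \<open>auto intro: bidual_embedding_nonneg\<close>)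

section \<open>Approximating pairs in the bidual by pairs in the space\<close>

lemma norm_dual_witness:
  fixes f :: "'a::real_normed_vector dual_space"
  assumes "c < norm f"
  obtains x where "norm x \<le> 1" "c < dual_apply f x"
proof -
  have "\<exists>x. norm x \<le> 1 \<and> c < dual_apply f x"
  proof (rule ccontr)
    assume "\<not> ?thesis"
    then have le: "dual_apply f x \<le> c" if "norm x \<le> 1" for x using that by force
    have "0 \<le> c" using le[of 0] by simp
    moreover have "\<bar>dual_apply f x\<bar> \<le> c * norm x" for x
    proof -
      have x: "x = norm x *\<^sub>R sgn x" by (cases "x = 0") (simp_all add: sgn_div_norm)
      have "norm (sgn x) \<le> 1" by (simp add: norm_sgn)
      then have "\<bar>dual_apply f (sgn x)\<bar> \<le> c"
        using le[of "sgn x"] le[of "- sgn x"] by (simp add: abs_le_iff)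
      then have "norm x * \<bar>dual_apply f (sgn x)\<bar> \<le> norm x * c" by (intro mult_left_mono) auto
      then show ?thesis
        by (subst x) (simp only: dual_apply_simps abs_mult abs_norm_cancel mult.commute[of c])
    qed
    ultimately have "norm f \<le> c" by (rule norm_dual_bound)
    then show False using assms by simp
  qed
  then show thesis using that by blast
qed

lemma norm_dual_witness_nonneg:
  fixes f :: "'a::banach_lattice dual_space"
  assumes f: "0 \<le> f" and c: "c < norm f"
  obtains x where "0 \<le> x" "norm x \<le> 1" "c < dual_apply f x"
proof -
  obtain x where x: "norm x \<le> 1" "c < dual_apply f x" using norm_dual_witness[OF c] .
  have "dual_apply f x \<le> dual_apply f \<bar>x\<bar>"
    by (rule dual_apply_mono[OF f]) (rule abs_banach_lattice_ge)
  then show thesis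
    using that[of "\<bar>x\<bar>"] x by (simp add: norm_abs_banach_lattice abs_banach_lattice_ge)
qed

text \<open>
  A convex subset of the plane that misses the quadrant above \<open>(p - e, q - e)\<close> is separated from
  it by a line.  Since the quadrant is unbounded, the normal \<open>(a, b)\<close> of that line has
  nonnegative entries, so only such directions have to be tested.
\<close>

lemma convex_meets_quadrant:
  fixes C :: "(real \<times> real) set"
  assumes C: "convex C" and e: "0 < e"
    and support: "\<And>a b e. 0 \<le> a \<Longrightarrow> 0 \<le> b \<Longrightarrow> 0 < e \<Longrightarrow>
      \<exists>(u, v)\<in>C. a * p + b * q - e \<le> a * u + b * v"
  obtains u v where "(u, v) \<in> C" "p - e \<le> u" "q - e \<le> v"
proof -
  define D where "D = {p - e..} \<times> {q - e..}"
  have "C \<inter> D \<noteq> {}"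
  proof
    assume "C \<inter> D = {}"
    moreover have "convex D" unfolding D_def by (intro convex_Times convex_real_interval)
    moreover have "C \<noteq> {}" using support[of 0 0 1] by auto
    moreover have "D \<noteq> {}" by (auto simp: D_def)
    ultimately obtain n k where n: "n \<noteq> 0" "\<And>z. z \<in> C \<Longrightarrow> n \<bullet> z \<le> k" "\<And>z. z \<in> D \<Longrightarrow> k \<le> n \<bullet> z"
      using separating_hyperplane_sets[of C D] C by blast
    obtain a b where ab: "n = (a, b)" by fastforce
    have kD: "k \<le> a * (p - e + s) + b * (q - e + t)" if "0 \<le> s" "0 \<le> t" for s t
      using n(3)[of "(p - e + s, q - e + t)"] that by (simp add: D_def ab)
    define m where "m = a * (p - e) + b * (q - e) - k"
    have m: "0 \<le> m + a * s + b * t" if "0 \<le> s" "0 \<le> t" for s t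
      using kD[OF that] by (simp add: m_def algebra_simps)
    have m0: "0 \<le> m" using m[of 0 0] by simp
    have "0 \<le> a"
    proof (rule ccontr)
      assume "\<not> 0 \<le> a"
      then show False using m[of "(m + 1) / (- a)" 0] m0 by (simp add: field_simps)
    qed
    moreover have "0 \<le> b"
    proof (rule ccontr)
      assume "\<not> 0 \<le> b"
      then show False using m[of 0 "(m + 1) / (- b)"] m0 by (simp add: field_simps)
    qed
    moreover have "a \<noteq> 0 \<or> b \<noteq> 0" using n(1) by (simp add: ab zero_prod_def)
    ultimately have pos: "0 \<le> a" "0 \<le> b" "0 < (a + b) * e" using e by auto
    obtain u v where uv: "(u, v) \<in> C" "a * p + b * q - (a + b) * e / 2 \<le> a * u + b * v"
      using support[of a b "(a + b) * e / 2"] pos by auto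
    have "a * u + b * v \<le> k" using n(2)[OF uv(1)] by (simp add: ab)
    moreover have "m = a * p + b * q - (a + b) * e - k" by (simp add: m_def algebra_simps)
    ultimately show False using uv(2) m0 pos(3) by linarith
  qed
  then show thesis using that by (auto simp: D_def)
qed

text \<open>
  Goldstine's theorem, tested on two functionals: on the ball of radius \<open>norm Z\<close> the combination
  \<open>a f + b g\<close> has supremum \<open>norm Z * norm (a f + b g)\<close>, which bounds its value under \<open>Z\<close>.
\<close>

lemma Goldstine_pair:
  fixes Z :: "'a::real_normed_vector bidual"
  assumes e: "0 < e"
  obtains z where "norm z \<le> norm Z" "dual_apply Z f - e \<le> dual_apply f z"
    "dual_apply Z g - e \<le> dual_apply g z"
proof -
  define C where "C = (\<lambda>z. (dual_apply f z, dual_apply g z)) ` cball 0 (norm Z)"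
  have "linear (\<lambda>z. (dual_apply f z, dual_apply g z))" by (rule linearI) simp_all
  then have "convex C" unfolding C_def by (rule convex_linear_image) (rule convex_cball)
  then obtain u v where "(u, v) \<in> C" "dual_apply Z f - e \<le> u" "dual_apply Z g - e \<le> v"
  proof (rule convex_meets_quadrant[OF _ e])
    fix a b d :: real assume "0 \<le> a" "0 \<le> b" and d: "0 < d"
    define h where "h = a *\<^sub>R f + b *\<^sub>R g"
    define c where "c = d / (norm Z + 1)"
    have "0 < norm Z + 1" by (simp add: add_nonneg_pos)
    then have c: "0 < c" "norm Z * c \<le> d"
      using d by (simp_all add: c_def pos_divide_le_eq algebra_simps)
    obtain w where w: "norm w \<le> 1" "norm h - c < dual_apply h w"
      using norm_dual_witness[of "norm h - c" h] c(1) by auto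
    have "norm Z * (norm h - c) \<le> norm Z * dual_apply h w"
      using w(2) by (intro mult_left_mono) auto
    then have "dual_apply Z h - d \<le> dual_apply h (norm Z *\<^sub>R w)"
      using c(2) norm_dual_apply_le[of Z h] by (simp add: right_diff_distrib)
    moreover have "norm Z *\<^sub>R w \<in> cball 0 (norm Z)"
      using w(1) by (simp add: mult_left_le)
    ultimately show "\<exists>(u, v)\<in>C. a * dual_apply Z f + b * dual_apply Z g - d \<le> a * u + b * v"
      unfolding C_def by (intro bexI[OF _ imageI[of "norm Z *\<^sub>R w"]]) (simp_all add: h_def algebra_simps)
  qed
  then show thesis using that by (auto simp: C_def)
qed

text \<open>
  Splitting a positive \<open>w\<close> optimally into \<open>x + y\<close> turns \<open>a f x + b g y\<close> into
  \<open>(sup (a f) (b g)) w\<close>, by the Riesz--Kantorovich formula.  So for \<open>a, b \<ge> 0\<close> the supremum of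
  \<open>a f x + b g y\<close> over positive \<open>x\<close> and \<open>y\<close> with \<open>norm (x + y) \<le> r\<close> is
  \<open>r * norm (sup (a f) (b g))\<close>.  With \<open>r = norm (F + G)\<close> this is at least
  \<open>(F + G) (sup (a f) (b g))\<close>, hence at least \<open>a F f + b G g\<close>.
\<close>

lemma Goldstine_nonneg_pair:
  fixes F G :: "'a::banach_lattice bidual"
  assumes FG: "0 \<le> F" "0 \<le> G" and fg: "0 \<le> f" "0 \<le> g" and e: "0 < e"
  obtains x y where "0 \<le> x" "0 \<le> y" "norm (x + y) \<le> norm (F + G)"
    "dual_apply F f - e \<le> dual_apply f x" "dual_apply G g - e \<le> dual_apply g y"
proof -
  define r where "r = norm (F + G)"
  define S where "S = {(x :: 'a, y). 0 \<le> x \<and> 0 \<le> y \<and> norm (x + y) \<le> r}"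
  define C where "C = (\<lambda>(x, y). (dual_apply f x, dual_apply g y)) ` S"
  have "convex S"
  proof (rule convexI)
    fix s t :: "'a \<times> 'a" and u v :: real
    assume st: "s \<in> S" "t \<in> S" and uv: "0 \<le> u" "0 \<le> v" "u + v = 1"
    obtain x y x' y' where xy: "s = (x, y)" "t = (x', y')" by fastforce
    have "norm (u *\<^sub>R (x + y) + v *\<^sub>R (x' + y')) \<le> u * norm (x + y) + v * norm (x' + y')"
      using uv by (intro norm_triangle_le) simp
    also have "\<dots> \<le> u * r + v * r"
      using st uv by (intro add_mono mult_left_mono) (auto simp: S_def xy)
    also have "\<dots> = r" using uv(3) by (simp flip: distrib_right)
    finally have "norm (u *\<^sub>R x + v *\<^sub>R x' + (u *\<^sub>R y + v *\<^sub>R y')) \<le> r"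
      by (simp add: algebra_simps)
    then show "u *\<^sub>R s + v *\<^sub>R t \<in> S"
      using st uv by (auto simp: S_def xy intro!: add_nonneg_nonneg scaleR_nonneg_nonneg)
  qed
  moreover have "linear (\<lambda>(x, y). (dual_apply f x, dual_apply g y))"
    by (rule linearI) auto
  ultimately have "convex C" unfolding C_def by (intro convex_linear_image)
  then obtain u v where "(u, v) \<in> C" "dual_apply F f - e \<le> u" "dual_apply G g - e \<le> v"
  proof (rule convex_meets_quadrant[OF _ e])
    fix a b d :: real assume ab: "0 \<le> a" "0 \<le> b" and d: "0 < d"
    define h where "h = sup (a *\<^sub>R f) (b *\<^sub>R g)"
    have "0 \<le> a *\<^sub>R f" using ab fg by (intro scaleR_nonneg_nonneg)
    then have h: "0 \<le> h" unfolding h_def by (rule le_supI1)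
    have r: "0 \<le> r" by (simp add: r_def)
    define c where "c = d / (r + 1)"
    have c: "0 < c" "r * c \<le> d"
      using d r by (auto simp: c_def field_simps)
    obtain w where w: "0 \<le> w" "norm w \<le> 1" "norm h - c / 2 < dual_apply h w"
      using norm_dual_witness_nonneg[OF h, of "norm h - c / 2"] c(1) by auto
    have "dual_apply h w - dual_apply (b *\<^sub>R g) w - c / 2 <
        (SUP y\<in>{0..w}. dual_apply (a *\<^sub>R f - b *\<^sub>R g) y)"
      using dual_sup_apply(1)[OF w(1), of "a *\<^sub>R f" "b *\<^sub>R g"] c(1) by (simp add: h_def)
    then obtain y where y: "0 \<le> y" "y \<le> w"
      "dual_apply h w - dual_apply (b *\<^sub>R g) w - c / 2 < dual_apply (a *\<^sub>R f - b *\<^sub>R g) y"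
      using less_cSUP_iff[OF _ dual_sup_apply(2)[OF w(1), of "a *\<^sub>R f" "b *\<^sub>R g"]] w(1)
      by (auto simp del: dual_apply_simps)
    have "r * (norm h - c) \<le> r * (a * dual_apply f y + b * dual_apply g (w - y))"
      using w(3) y(3) r by (intro mult_left_mono) (auto simp: right_diff_distrib)
    moreover have "dual_apply (F + G) h \<le> r * norm h"
      using norm_dual_apply_le[of "F + G" h] by (simp add: r_def)
    moreover have "dual_apply F (a *\<^sub>R f) \<le> dual_apply F h" "dual_apply G (b *\<^sub>R g) \<le> dual_apply G h"
      unfolding h_def by (intro dual_apply_mono FG sup_ge1 sup_ge2)+
    ultimately have "a * dual_apply F f + b * dual_apply G g - d \<le>
        a * dual_apply f (r *\<^sub>R y) + b * dual_apply g (r *\<^sub>R (w - y))"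
      using c(2) by (simp add: algebra_simps)
    moreover have "(r *\<^sub>R y, r *\<^sub>R (w - y)) \<in> S"
      using y w r
      by (auto simp: S_def mult_left_le simp flip: scaleR_add_right intro: scaleR_nonneg_nonneg)
    ultimately show "\<exists>(u, v)\<in>C. a * dual_apply F f + b * dual_apply G g - d \<le> a * u + b * v"
      unfolding C_def by (intro bexI[OF _ imageI]) auto
  qed
  then show thesis using that by (auto simp: C_def S_def r_def)
qed

section \<open>Comparing the constants of two lattices\<close>

lemma norm_diff_le_norm_add:
  fixes x y :: "'a::banach_lattice"
  assumes "0 \<le> x" "0 \<le> y"
  shows "norm (x - y) \<le> norm (x + y)"
proof (rule norm_le_of_abs_le)
  have "x - y \<le> x + y" "y - x \<le> x + y"
    using assms by (simp_all add: diff_le_eq add.assoc add_increasing add_increasing2)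
  then show "\<bar>x - y\<bar> \<le> x + y" unfolding abs_lattice[of "x - y"] minus_diff_eq by (rule le_supI)
qed

lemma sup_eq_add_of_disjoint: "inf x y = 0 \<Longrightarrow> sup x y = x + y"
  for x y :: "'a::banach_lattice"
  using add_eq_inf_sup[of x y] by simp

lemma disjoint_parts:
  fixes x y :: "'a::banach_lattice"
  shows "0 \<le> x - inf x y" "0 \<le> y - inf x y" "inf (x - inf x y) (y - inf x y) = 0"
proof -
  show "0 \<le> x - inf x y" "0 \<le> y - inf x y" by (simp_all only: diff_ge_0_iff_ge inf_le1 inf_le2)
  show "inf (x - inf x y) (y - inf x y) = 0"
    using add_inf_distrib_right[of x y "- inf x y"]
    by (simp only: add_uminus_conv_diff diff_self)
qed

lemma normalized_pair:
  fixes u v :: "'a::banach_lattice"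
  assumes uv: "0 \<le> u" "0 \<le> v" and t: "0 < t" "t \<le> norm u" "t \<le> norm v"
  obtains x y :: 'a where "0 \<le> x" "0 \<le> y" "norm x = 1" "norm y = 1"
    "norm (x + y) \<le> norm (u + v) / t" "inf u v = 0 \<longrightarrow> inf x y = 0"
proof -
  define x where "x = inverse (norm u) *\<^sub>R u"
  define y where "y = inverse (norm v) *\<^sub>R v"
  have nonneg: "0 \<le> x" "0 \<le> y" using uv by (simp_all add: x_def y_def scaleR_nonneg_nonneg)
  have "norm u \<noteq> 0" "norm v \<noteq> 0" using t by linarith+
  then have unit: "norm x = 1" "norm y = 1" by (simp_all add: x_def y_def)
  have le: "x \<le> inverse t *\<^sub>R u" "y \<le> inverse t *\<^sub>R v"
    unfolding x_def y_def using uv t by (intro scaleR_right_mono le_imp_inverse_le; simp)+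
  have "norm (x + y) \<le> norm (inverse t *\<^sub>R u + inverse t *\<^sub>R v)"
    using nonneg le by (intro norm_pos_mono add_mono add_nonneg_nonneg)
  also have "\<dots> = norm (u + v) / t"
    using t(1) by (simp add: divide_inverse mult.commute flip: scaleR_add_right)
  finally have sum: "norm (x + y) \<le> norm (u + v) / t" .
  have disjoint: "inf u v = 0 \<longrightarrow> inf x y = 0"
  proof (intro impI antisym)
    assume disj: "inf u v = 0"
    have "t *\<^sub>R inf x y \<le> t *\<^sub>R (inverse t *\<^sub>R u)"
      by (rule scaleR_left_mono[OF le_infI1[OF le(1)]]) (use t in simp)
    moreover have "t *\<^sub>R inf x y \<le> t *\<^sub>R (inverse t *\<^sub>R v)"
      by (rule scaleR_left_mono[OF le_infI2[OF le(2)]]) (use t in simp)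
    ultimately have "t *\<^sub>R inf x y \<le> inf u v" using t(1) by simp
    then have "inverse t *\<^sub>R (t *\<^sub>R inf x y) \<le> inverse t *\<^sub>R 0"
      unfolding disj using t(1) by (intro scaleR_left_mono) auto
    then show "inf x y \<le> 0" using t(1) by simp
    show "0 \<le> inf x y" using nonneg by (rule le_infI)
  qed
  show thesis by (rule that[OF nonneg unit sum disjoint])
qed

text \<open>
  The approximations below produce pairs whose norms are only almost \<open>1\<close>.  For positive vectors
  this is harmless: rescaling both to norm \<open>1\<close> increases the norm of the sum by a factor of at
  most \<open>1 / (1 - d)\<close> and preserves disjointness.
\<close>

lemma unit_pair_of_near_unit_pairs:
  assumes near: "\<And>d. 0 < d \<Longrightarrow> \<exists>u v :: 'a::banach_lattice. 0 \<le> u \<and> 0 \<le> v \<and>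
      1 - d \<le> norm u \<and> 1 - d \<le> norm v \<and> norm (u + v) \<le> r + d \<and> (D \<longrightarrow> inf u v = 0)"
    and e: "0 < e"
  obtains x y :: "'a::banach_lattice"
  where "0 \<le> x" "0 \<le> y" "norm x = 1" "norm y = 1" "norm (x + y) \<le> r + e"
    "D \<longrightarrow> inf x y = 0"
proof -
  \<comment> \<open>chosen such that \<open>r + d \<le> (r + e) * (1 - d)\<close>\<close>
  define d where "d = e / (1 + \<bar>r\<bar> + e)"
  have pos: "0 < 1 + \<bar>r\<bar> + e" using e by simp
  then have d: "0 < d" "d < 1" "d * (1 + \<bar>r\<bar> + e) = e" using e by (auto simp: d_def field_simps)
  have "d * (1 + r + e) \<le> e" using mult_left_mono[of "1 + r + e" "1 + \<bar>r\<bar> + e" d] d by simp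
  then have small: "(r + d) / (1 - d) \<le> r + e" using d(2) by (simp add: field_simps)
  obtain u v :: 'a where uv: "0 \<le> u" "0 \<le> v" "1 - d \<le> norm u" "1 - d \<le> norm v"
    "norm (u + v) \<le> r + d" "D \<longrightarrow> inf u v = 0"
    using near[OF d(1)] by blast
  have t: "0 < 1 - d" using d(2) by simp
  obtain x y :: 'a where xy: "0 \<le> x" "0 \<le> y" "norm x = 1" "norm y = 1"
    "norm (x + y) \<le> norm (u + v) / (1 - d)" "inf u v = 0 \<longrightarrow> inf x y = 0"
    using normalized_pair[OF uv(1,2) t uv(3,4)] by blast
  have "norm (u + v) / (1 - d) \<le> (r + d) / (1 - d)"
    using uv(5) d(2) by (intro divide_right_mono) auto
  then have "norm (x + y) \<le> r + e" using xy(5) small by linarith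
  then show thesis using that xy(1-4,6) uv(6) by blast
qed

text \<open>
  By \<open>below\<close> and \<open>approx\<close> one of the sets is empty only if the other is, and then both infima are
  the same unspecified real number.
\<close>

lemma Inf_eq_of_approx:
  fixes A B :: "real set"
  assumes nonneg: "\<And>b. b \<in> B \<Longrightarrow> 0 \<le> b"
    and below: "\<And>b. b \<in> B \<Longrightarrow> \<exists>a\<in>A. a \<le> b"
    and approx: "\<And>a e. a \<in> A \<Longrightarrow> 0 < e \<Longrightarrow> \<exists>b\<in>B. b \<le> a + e"
  shows "Inf B = Inf A"
proof (cases "B = {}")
  case True
  then have "A = {}" using approx[of _ 1] by auto
  then show ?thesis using True by simp
next
  case False
  then have neA: "A \<noteq> {}" using below by blast
  have bddB: "bdd_below B" using nonneg by (rule bdd_belowI)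
  have lower: "Inf B \<le> a" if "a \<in> A" for a
  proof (rule field_le_epsilon)
    fix e :: real assume "0 < e"
    then obtain b where "b \<in> B" "b \<le> a + e" using approx \<open>a \<in> A\<close> by blast
    then show "Inf B \<le> a + e" using cInf_lower[OF _ bddB] order_trans by blast
  qed
  then have bddA: "bdd_below A" by (rule bdd_belowI)
  show ?thesis
  proof (rule antisym)
    show "Inf B \<le> Inf A" using neA lower by (rule cInf_greatest)
    show "Inf A \<le> Inf B"
    proof (rule cInf_greatest[OF False])
      fix b assume "b \<in> B"
      then obtain a where "a \<in> A" "a \<le> b" using below by blast
      then show "Inf A \<le> b" using cInf_lower[OF _ bddA] order_trans by blast
    qed
  qed
qed

lemma pos_sphere_lattice_of: "x \<in> pos_sphere (lattice_of T) \<longleftrightarrow> 0 \<le> x \<and> norm x = 1"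
  by (simp add: pos_sphere_def lattice_of_def)

lemma lattice_of_simps:
  "nl_zero (lattice_of T) = 0" "nl_add (lattice_of T) x y = x + y"
  "nl_diff (lattice_of T) x y = x - y" "nl_join (lattice_of T) x y = sup x y"
  "nl_meet (lattice_of T) x y = inf x y" "nl_norm (lattice_of T) x = norm x"
  by (simp_all add: lattice_of_def nl_diff_def)

text \<open>
  Since \<open>norm (x - y) \<le> norm (x + y)\<close> for positive \<open>x\<close> and \<open>y\<close>, only the sum has to be
  controlled when a pair in \<open>L\<close> is replaced by a pair of vectors.
\<close>

lemma lattice_schaffer_eqI:
  fixes L :: "'b normed_lattice"
  assumes image: "\<And>x y :: 'a::banach_lattice. 0 \<le> x \<Longrightarrow> 0 \<le> y \<Longrightarrow> norm x = 1 \<Longrightarrow> norm y = 1 \<Longrightarrow>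
      \<exists>X\<in>pos_sphere L. \<exists>Y\<in>pos_sphere L.
        nl_norm L (nl_diff L X Y) = norm (x - y) \<and> nl_norm L (nl_add L X Y) = norm (x + y)"
    and near: "\<And>X Y d. X \<in> pos_sphere L \<Longrightarrow> Y \<in> pos_sphere L \<Longrightarrow> 0 < d \<Longrightarrow>
      \<exists>u v :: 'a. 0 \<le> u \<and> 0 \<le> v \<and> 1 - d \<le> norm u \<and> 1 - d \<le> norm v \<and>
        norm (u + v) \<le> nl_norm L (nl_add L X Y) + d"
  shows "lattice_schaffer (lattice_of TYPE('a)) = lattice_schaffer L"
  unfolding lattice_schaffer_def lattice_of_simps pos_sphere_lattice_of
proof (rule Inf_eq_of_approx, goal_cases)
  case (1 b)
  then show ?case by (auto simp: le_max_iff_disj)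
next
  case (2 b)
  then obtain x y :: 'a where xy: "0 \<le> x" "0 \<le> y" "norm x = 1" "norm y = 1"
    and b: "b = max (norm (x - y)) (norm (x + y))"
    by blast
  obtain X Y where "X \<in> pos_sphere L" "Y \<in> pos_sphere L"
    "nl_norm L (nl_diff L X Y) = norm (x - y)" "nl_norm L (nl_add L X Y) = norm (x + y)"
    using image[OF xy] by blast
  then have "b \<in> {max (nl_norm L (nl_diff L X Y)) (nl_norm L (nl_add L X Y)) | X Y.
      X \<in> pos_sphere L \<and> Y \<in> pos_sphere L}"
    unfolding b by (metis (mono_tags, lifting) mem_Collect_eq)
  then show ?case by blast
next
  case (3 a e)
  then obtain X Y where XY: "X \<in> pos_sphere L" "Y \<in> pos_sphere L"
    and a: "nl_norm L (nl_add L X Y) \<le> a"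
    by (auto simp: le_max_iff_disj)
  have "\<exists>u v :: 'a. 0 \<le> u \<and> 0 \<le> v \<and> 1 - d \<le> norm u \<and> 1 - d \<le> norm v \<and>
      norm (u + v) \<le> nl_norm L (nl_add L X Y) + d \<and> (False \<longrightarrow> inf u v = 0)" if "0 < d" for d
    using near[OF XY that] by simp
  then obtain x y :: 'a where xy: "0 \<le> x" "0 \<le> y" "norm x = 1" "norm y = 1"
    "norm (x + y) \<le> nl_norm L (nl_add L X Y) + e"
    using 3(2) by (rule unit_pair_of_near_unit_pairs)
  have "max (norm (x - y)) (norm (x + y)) \<le> a + e"
    using norm_diff_le_norm_add[OF xy(1,2)] xy(5) a by simp
  then show ?case using xy(1-4) by blast
qed

lemma beta_const_eqI:
  fixes L :: "'b normed_lattice"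
  assumes image: "\<And>x y :: 'a::banach_lattice. 0 \<le> x \<Longrightarrow> 0 \<le> y \<Longrightarrow> norm x = 1 \<Longrightarrow> norm y = 1 \<Longrightarrow>
      inf x y = 0 \<Longrightarrow> \<exists>X\<in>pos_sphere L. \<exists>Y\<in>pos_sphere L.
        nl_meet L X Y = nl_zero L \<and> nl_norm L (nl_join L X Y) = norm (x + y)"
    and near: "\<And>X Y d. X \<in> pos_sphere L \<Longrightarrow> Y \<in> pos_sphere L \<Longrightarrow> nl_meet L X Y = nl_zero L \<Longrightarrow>
      0 < d \<Longrightarrow> \<exists>u v :: 'a. 0 \<le> u \<and> 0 \<le> v \<and> 1 - d \<le> norm u \<and> 1 - d \<le> norm v \<and>
        norm (u + v) \<le> nl_norm L (nl_join L X Y) + d \<and> inf u v = 0"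
  shows "beta_const (lattice_of TYPE('a)) = beta_const L"
  unfolding beta_const_def lattice_of_simps pos_sphere_lattice_of
proof (rule Inf_eq_of_approx, goal_cases)
  case (1 b)
  then show ?case by auto
next
  case (2 b)
  then obtain x y :: 'a where xy: "0 \<le> x" "0 \<le> y" "norm x = 1" "norm y = 1" "inf x y = 0"
    and b: "b = norm (sup x y)"
    by blast
  obtain X Y where "X \<in> pos_sphere L" "Y \<in> pos_sphere L" "nl_meet L X Y = nl_zero L"
    "nl_norm L (nl_join L X Y) = b"
    using image[OF xy] unfolding b sup_eq_add_of_disjoint[OF xy(5)] by blast
  then show ?case by blast
next
  case (3 a e)
  then obtain X Y where XY: "X \<in> pos_sphere L" "Y \<in> pos_sphere L" "nl_meet L X Y = nl_zero L"
    and a: "nl_norm L (nl_join L X Y) = a"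
    by auto
  have "\<exists>u v :: 'a. 0 \<le> u \<and> 0 \<le> v \<and> 1 - d \<le> norm u \<and> 1 - d \<le> norm v \<and>
      norm (u + v) \<le> a + d \<and> (True \<longrightarrow> inf u v = 0)" if "0 < d" for d
    using near[OF XY that] by (simp add: a)
  then obtain x y :: 'a where xy: "0 \<le> x" "0 \<le> y" "norm x = 1" "norm y = 1"
    "norm (x + y) \<le> a + e" "True \<longrightarrow> inf x y = 0"
    using 3(2) by (rule unit_pair_of_near_unit_pairs)
  have "norm (sup x y) \<le> a + e" using xy(5,6) sup_eq_add_of_disjoint[of x y] by simp
  then show ?case using xy by blast
qed

section \<open>The bidual\<close>

text \<open>
  Positive functionals \<open>f\<close> and \<open>g\<close> of norm at most \<open>1\<close> that almost norm \<open>F\<close> and \<open>G\<close> transfer the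
  lower bounds on the norms, since \<open>f x \<le> norm x\<close> and \<open>g y \<le> norm y\<close>.
\<close>

lemma lattice_schaffer_bidual:
  "lattice_schaffer (lattice_of TYPE('a::banach_lattice)) = lattice_schaffer (lattice_of TYPE('a bidual))"
proof (rule lattice_schaffer_eqI, goal_cases)
  case (1 x y)
  have "bidual_embedding (x - y) = bidual_embedding x - bidual_embedding y"
    by (rule dual_space_eqI) simp
  then show ?case
    using 1 norm_bidual_embedding[of "x - y"] norm_bidual_embedding[of "x + y"]
    by (intro bexI[of _ "bidual_embedding x"] bexI[of _ "bidual_embedding y"])
      (simp_all add: pos_sphere_lattice_of bidual_embedding_nonneg norm_bidual_embedding
        lattice_of_simps bidual_embedding_add)
next
  case (2 F G d)
  then have FG: "0 \<le> F" "0 \<le> G" "1 - d / 2 < norm F" "1 - d / 2 < norm G"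
    by (simp_all add: pos_sphere_lattice_of)
  obtain f where f: "0 \<le> f" "norm f \<le> 1" "1 - d / 2 < dual_apply F f"
    using norm_dual_witness_nonneg[OF FG(1,3)] .
  obtain g where g: "0 \<le> g" "norm g \<le> 1" "1 - d / 2 < dual_apply G g"
    using norm_dual_witness_nonneg[OF FG(2,4)] .
  obtain x y where xy: "0 \<le> x" "0 \<le> y" "norm (x + y) \<le> norm (F + G)"
    "dual_apply F f - d / 2 \<le> dual_apply f x" "dual_apply G g - d / 2 \<le> dual_apply g y"
    using Goldstine_nonneg_pair[OF FG(1,2) f(1) g(1), of "d / 2"] 2(3) by auto
  have "1 - d \<le> norm x" using xy(4) f dual_apply_le_norm[OF f(2), of x] by simp
  moreover have "1 - d \<le> norm y" using xy(5) g dual_apply_le_norm[OF g(2), of y] by simp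
  ultimately show ?case using xy 2(3)
    by (intro exI[of _ x] exI[of _ y]) (simp add: lattice_of_simps)
qed

text \<open>
  By disjointness \<open>F\<close> is the positive part of \<open>F - G\<close>, so its value at a positive \<open>w\<close> is the
  supremum of \<open>F - G\<close> over the interval from \<open>0\<close> to \<open>w\<close>.
\<close>

lemma disjoint_functional_witness:
  fixes F G :: "'a::banach_lattice dual_space"
  assumes F: "0 \<le> F" and disj: "inf F G = 0" and c: "c < norm F"
  obtains x where "0 \<le> x" "norm x \<le> 1" "c < dual_apply (F - G) x"
proof -
  obtain w where w: "0 \<le> w" "norm w \<le> 1" "c < dual_apply F w"
    using norm_dual_witness_nonneg[OF F c] .
  have "c < (SUP x\<in>{0..w}. dual_apply (F - G) x)"
    using dual_sup_apply(1)[OF w(1), of F G] w(3) by (simp add: sup_eq_add_of_disjoint[OF disj])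
  then obtain x where x: "0 \<le> x" "x \<le> w" "c < dual_apply (F - G) x"
    using less_cSUP_iff[OF _ dual_sup_apply(2)[OF w(1), of F G]] w(1)
    by (auto simp del: dual_apply_simps)
  then show thesis using that norm_pos_mono[OF x(1,2)] w(2) by fastforce
qed

text \<open>
  The positive and negative parts of a single \<open>z\<close> are disjoint, so \<open>z\<close> has to approximate
  \<open>F - G\<close> only: the norms of \<open>F\<close> and \<open>G\<close> are visible in the values of \<open>F - G\<close> at two positive
  functionals, and \<open>norm (F - G) \<le> norm (sup F G)\<close>.
\<close>

lemma beta_const_bidual:
  "beta_const (lattice_of TYPE('a::banach_lattice)) = beta_const (lattice_of TYPE('a bidual))"
proof (rule beta_const_eqI, goal_cases)
  case (1 x y)
  note disj = bidual_embedding_disjoint[OF 1(1,2,5)]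
  show ?case
    using 1 disj norm_bidual_embedding[of "x + y"]
    by (intro bexI[of _ "bidual_embedding x"] bexI[of _ "bidual_embedding y"])
      (simp_all add: pos_sphere_lattice_of bidual_embedding_nonneg norm_bidual_embedding
        lattice_of_simps bidual_embedding_add sup_eq_add_of_disjoint)
next
  case (2 F G d)
  then have FG: "0 \<le> F" "0 \<le> G" "1 - d / 2 < norm F" "1 - d / 2 < norm G"
    and disj: "inf F G = 0"
    by (simp_all add: pos_sphere_lattice_of lattice_of_simps)
  obtain f where f: "0 \<le> f" "norm f \<le> 1" "1 - d / 2 < dual_apply (F - G) f"
    using disjoint_functional_witness[OF FG(1) disj FG(3)] .
  obtain g where g: "0 \<le> g" "norm g \<le> 1" "1 - d / 2 < dual_apply (G - F) g"
    using disjoint_functional_witness[OF FG(2) _ FG(4)] disj by (metis inf.commute)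
  obtain z where z: "norm z \<le> norm (F - G)" "dual_apply (F - G) f - d / 2 \<le> dual_apply f z"
    "dual_apply (F - G) (- g) - d / 2 \<le> dual_apply (- g) z"
    using Goldstine_pair[of "d / 2" "F - G" f "- g"] 2(4) by auto
  define u v where "u = pprt z" and "v = - nprt z"
  have "z \<le> u" "- z \<le> v" "u + v = \<bar>z\<bar>"
    by (simp_all only: u_def v_def pprt_def nprt_def abs_prts[of z] neg_le_iff_le sup_ge1 inf_le1
        add_uminus_conv_diff)
  have "dual_apply f z \<le> dual_apply f u" "dual_apply g (- z) \<le> dual_apply g v"
    using dual_apply_mono f(1) g(1) \<open>z \<le> u\<close> \<open>- z \<le> v\<close> by blast+
  then have "1 - d \<le> norm u" "1 - d \<le> norm v"
    using f(3) g(3) z(2,3) dual_apply_le_norm[OF f(2), of u] dual_apply_le_norm[OF g(2), of v]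
    by simp_all
  moreover have "norm (u + v) \<le> norm (sup F G) + d"
    using z(1) norm_diff_le_norm_add[OF FG(1,2)] 2(4)
    by (simp add: \<open>u + v = \<bar>z\<bar>\<close> norm_abs_banach_lattice sup_eq_add_of_disjoint[OF disj])
  ultimately show ?case
    using disjoint_parts[of z 0] pprt_diff[of z 0]
    by (intro exI[of _ u] exI[of _ v]) (simp add: lattice_of_simps u_def v_def nprt_def)
qed

section \<open>The ultrapower\<close>

lemma ultra_norm_tendsto:
  fixes x :: "nat \<Rightarrow>\<^sub>C 'a::banach_lattice"
  assumes "free_ultrafilter U"
  shows "((\<lambda>n. norm (apply_bcontfun x n)) \<longlongrightarrow> nl_norm (ultrapower U TYPE('a)) (ultra_rel U `` {x})) U"
  unfolding ultra_norm_class[OF assms]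
  by (rule bounded_seq_tendsto_Lim[OF assms, of _ 0 "norm x"]) (simp add: norm_bounded)

lemma ultra_class_eq_zero_iff:
  "ultra_rel U `` {x} = ultra_rel U `` {0} \<longleftrightarrow> ((\<lambda>n. norm (apply_bcontfun x n)) \<longlongrightarrow> 0) U"
  using eq_equiv_class_iff[OF equiv_ultra_rel, of x 0 U] by (simp add: ultra_rel_def c0U_def)

lemma pos_sphere_ultrapower_class:
  fixes x :: "nat \<Rightarrow>\<^sub>C 'a::banach_lattice"
  shows "ultra_rel U `` {x} \<in> pos_sphere (ultrapower U TYPE('a)) \<longleftrightarrow>
    ((\<lambda>n. norm (nprt (apply_bcontfun x n))) \<longlongrightarrow> 0) U \<and>
    nl_norm (ultrapower U TYPE('a)) (ultra_rel U `` {x}) = 1"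
proof -
  have "nl_le (ultrapower U TYPE('a)) (ultra_rel U `` {0}) (ultra_rel U `` {x}) \<longleftrightarrow>
      nl_meet (ultrapower U TYPE('a)) (ultra_rel U `` {0}) (ultra_rel U `` {x}) = ultra_rel U `` {0}"
    by (simp add: ultrapower_def)
  also have "\<dots> \<longleftrightarrow> ((\<lambda>n. norm (nprt (apply_bcontfun x n))) \<longlongrightarrow> 0) U"
    by (simp add: ultra_ops_class ultra_class_eq_zero_iff apply_seq_inf nprt_def inf.commute)
  finally show ?thesis
    by (auto simp: pos_sphere_def ultrapower_def intro: quotientI)
qed

lemma pos_sphere_ultrapowerE:
  fixes X :: "(nat \<Rightarrow>\<^sub>C 'a::banach_lattice) set"
  assumes U: "free_ultrafilter U" and X: "X \<in> pos_sphere (ultrapower U TYPE('a))"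
  obtains x where "X = ultra_rel U `` {x}" "((\<lambda>n. norm (apply_bcontfun x n)) \<longlongrightarrow> 1) U"
    "((\<lambda>n. norm (nprt (apply_bcontfun x n))) \<longlongrightarrow> 0) U"
proof -
  have "X \<in> UNIV // ultra_rel U" using X by (simp add: pos_sphere_def ultrapower_def)
  then obtain x where x: "X = ultra_rel U `` {x}" by (rule quotientE)
  then show thesis
    using that[OF x] X ultra_norm_tendsto[OF U, of x] pos_sphere_ultrapower_class[of U x] by simp
qed

lemma nl_norm_const_class:
  fixes x :: "'a::banach_lattice"
  assumes U: "free_ultrafilter U"
  shows "nl_norm (ultrapower U TYPE('a)) (ultra_rel U `` {const_bcontfun x}) = norm x"
  unfolding ultra_norm_class[OF U] using U
  by (simp add: free_ultrafilter_def const_bcontfun.rep_eq tendsto_Lim)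

lemma const_class_in_pos_sphere:
  fixes x :: "'a::banach_lattice"
  assumes "free_ultrafilter U" "0 \<le> x" "norm x = 1"
  shows "ultra_rel U `` {const_bcontfun x} \<in> pos_sphere (ultrapower U TYPE('a))"
  using assms by (simp add: pos_sphere_ultrapower_class nl_norm_const_class const_bcontfun.rep_eq)

lemma nl_diff_ultra_class:
  fixes x y :: "nat \<Rightarrow>\<^sub>C 'a::banach_lattice"
  shows "nl_diff (ultrapower U TYPE('a)) (ultra_rel U `` {x}) (ultra_rel U `` {y}) =
    ultra_rel U `` {x - y}"
  by (simp add: nl_diff_def ultra_ops_class)

text \<open>
  The vectors are read off at one index of a large set: representatives of a positive pair are
  positive there up to a small error, which passing to positive parts removes.
\<close>

lemma lattice_schaffer_ultrapower:
  assumes U: "free_ultrafilter U"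
  shows "lattice_schaffer (lattice_of TYPE('a::banach_lattice)) = lattice_schaffer (ultrapower U TYPE('a))"
proof (rule lattice_schaffer_eqI, goal_cases)
  case (1 x y)
  have "const_bcontfun x - const_bcontfun y = (const_bcontfun (x - y) :: nat \<Rightarrow>\<^sub>C 'a)"
    "const_bcontfun x + const_bcontfun y = (const_bcontfun (x + y) :: nat \<Rightarrow>\<^sub>C 'a)"
    by (auto intro!: bcontfun_eqI simp: const_bcontfun.rep_eq)
  then show ?case
    using 1 by (intro bexI[OF _ const_class_in_pos_sphere[OF U 1(1,3)]]
        bexI[OF _ const_class_in_pos_sphere[OF U 1(2,4)]])
      (simp_all add: nl_diff_ultra_class ultra_ops_class nl_norm_const_class[OF U])
next
  case (2 X Y d)
  obtain x where x: "X = ultra_rel U `` {x}" "((\<lambda>n. norm (apply_bcontfun x n)) \<longlongrightarrow> 1) U"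
    "((\<lambda>n. norm (nprt (apply_bcontfun x n))) \<longlongrightarrow> 0) U"
    using pos_sphere_ultrapowerE[OF U 2(1)] .
  obtain y where y: "Y = ultra_rel U `` {y}" "((\<lambda>n. norm (apply_bcontfun y n)) \<longlongrightarrow> 1) U"
    "((\<lambda>n. norm (nprt (apply_bcontfun y n))) \<longlongrightarrow> 0) U"
    using pos_sphere_ultrapowerE[OF U 2(2)] .
  define r where "r = nl_norm (ultrapower U TYPE('a)) (nl_add (ultrapower U TYPE('a)) X Y)"
  have s: "((\<lambda>n. norm (apply_bcontfun (x + y) n)) \<longlongrightarrow> r) U"
    using ultra_norm_tendsto[OF U, of "x + y"] by (simp add: r_def x(1) y(1) ultra_ops_class)
  have d: "1 - d / 3 < 1" "0 < d / 3" "r < r + d / 3" using 2(3) by simp_all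
  have "\<forall>\<^sub>F n in U. 1 - d / 3 < norm (apply_bcontfun x n) \<and> 1 - d / 3 < norm (apply_bcontfun y n) \<and>
      norm (nprt (apply_bcontfun x n)) < d / 3 \<and> norm (nprt (apply_bcontfun y n)) < d / 3 \<and>
      norm (apply_bcontfun (x + y) n) < r + d / 3"
    by (intro eventually_conj order_tendstoD(1)[OF x(2) d(1)] order_tendstoD(1)[OF y(2) d(1)]
        order_tendstoD(2)[OF x(3) d(2)] order_tendstoD(2)[OF y(3) d(2)] order_tendstoD(2)[OF s d(3)])
  then obtain n where n: "1 - d / 3 < norm (apply_bcontfun x n)" "1 - d / 3 < norm (apply_bcontfun y n)"
      "norm (nprt (apply_bcontfun x n)) < d / 3" "norm (nprt (apply_bcontfun y n)) < d / 3"
      "norm (apply_bcontfun (x + y) n) < r + d / 3"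
    using eventually_happens[of _ U] U unfolding free_ultrafilter_def by blast
  define a b where "a = apply_bcontfun x n" and "b = apply_bcontfun y n"
  have parts: "pprt z = z - nprt z" for z :: 'a using prts[of z] by (simp add: eq_diff_eq)
  have "pprt a + pprt b = a + b - (nprt a + nprt b)" by (simp add: parts)
  then have "norm (pprt a + pprt b) \<le> norm (a + b) + (norm (nprt a) + norm (nprt b))"
    using norm_triangle_ineq4[of "a + b" "nprt a + nprt b"] norm_triangle_ineq[of "nprt a" "nprt b"]
    by simp
  moreover have "norm z - norm (nprt z) \<le> norm (pprt z)" for z :: 'a
    unfolding parts by (rule norm_triangle_ineq2)
  from this[of a] this[of b] have "1 - d \<le> norm (pprt a)" "1 - d \<le> norm (pprt b)"
    using n 2(3) by (simp_all add: a_def b_def)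
  ultimately show ?case
    using n by (intro exI[of _ "pprt a"] exI[of _ "pprt b"]) (simp add: a_def b_def flip: r_def)
qed

text \<open>
  Subtracting \<open>inf a b\<close>, which is small at a suitable index, makes the two entries \<open>a\<close> and \<open>b\<close>
  disjoint and positive at once, and their sum becomes \<open>sup a b - inf a b\<close>.
\<close>

lemma beta_const_ultrapower:
  assumes U: "free_ultrafilter U"
  shows "beta_const (lattice_of TYPE('a::banach_lattice)) = beta_const (ultrapower U TYPE('a))"
proof (rule beta_const_eqI, goal_cases)
  case (1 x y)
  have "seq_inf (const_bcontfun x) (const_bcontfun y) = 0"
    "seq_sup (const_bcontfun x) (const_bcontfun y) = const_bcontfun (x + y)"
    using 1(5) sup_eq_add_of_disjoint[OF 1(5)]
    by (auto intro!: bcontfun_eqI simp: const_bcontfun.rep_eq apply_seq_inf apply_seq_sup)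
  moreover have "nl_zero (ultrapower U TYPE('a)) = ultra_rel U `` {0}" by (simp add: ultrapower_def)
  ultimately show ?case
    using 1 by (intro bexI[OF _ const_class_in_pos_sphere[OF U 1(1,3)]]
        bexI[OF _ const_class_in_pos_sphere[OF U 1(2,4)]])
      (simp_all add: ultra_ops_class nl_norm_const_class[OF U])
next
  case (2 X Y d)
  obtain x where x: "X = ultra_rel U `` {x}" "((\<lambda>n. norm (apply_bcontfun x n)) \<longlongrightarrow> 1) U"
    using pos_sphere_ultrapowerE[OF U 2(1)] by blast
  obtain y where y: "Y = ultra_rel U `` {y}" "((\<lambda>n. norm (apply_bcontfun y n)) \<longlongrightarrow> 1) U"
    using pos_sphere_ultrapowerE[OF U 2(2)] by blast
  define r where "r = nl_norm (ultrapower U TYPE('a)) (nl_join (ultrapower U TYPE('a)) X Y)"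
  have s: "((\<lambda>n. norm (sup (apply_bcontfun x n) (apply_bcontfun y n))) \<longlongrightarrow> r) U"
    using ultra_norm_tendsto[OF U, of "seq_sup x y"]
    by (simp add: r_def x(1) y(1) ultra_ops_class apply_seq_sup)
  have "nl_zero (ultrapower U TYPE('a)) = ultra_rel U `` {0}" by (simp add: ultrapower_def)
  then have i: "((\<lambda>n. norm (inf (apply_bcontfun x n) (apply_bcontfun y n))) \<longlongrightarrow> 0) U"
    using 2(3) by (simp add: x(1) y(1) ultra_ops_class ultra_class_eq_zero_iff apply_seq_inf)
  have d: "1 - d / 2 < 1" "0 < d / 2" "r < r + d / 2" using 2(4) by simp_all
  have "\<forall>\<^sub>F n in U. 1 - d / 2 < norm (apply_bcontfun x n) \<and> 1 - d / 2 < norm (apply_bcontfun y n) \<and>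
      norm (inf (apply_bcontfun x n) (apply_bcontfun y n)) < d / 2 \<and>
      norm (sup (apply_bcontfun x n) (apply_bcontfun y n)) < r + d / 2"
    by (intro eventually_conj order_tendstoD(1)[OF x(2) d(1)] order_tendstoD(1)[OF y(2) d(1)]
        order_tendstoD(2)[OF i d(2)] order_tendstoD(2)[OF s d(3)])
  then obtain n where "1 - d / 2 < norm (apply_bcontfun x n) \<and> 1 - d / 2 < norm (apply_bcontfun y n) \<and>
      norm (inf (apply_bcontfun x n) (apply_bcontfun y n)) < d / 2 \<and>
      norm (sup (apply_bcontfun x n) (apply_bcontfun y n)) < r + d / 2"
    using eventually_happens[of _ U] U unfolding free_ultrafilter_def by blast
  then obtain a b :: 'a where n: "1 - d / 2 < norm a" "1 - d / 2 < norm b"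
    "norm (inf a b) < d / 2" "norm (sup a b) < r + d / 2" by blast
  define u v where "u = a - inf a b" and "v = b - inf a b"
  have "1 - d \<le> norm u" "1 - d \<le> norm v"
    unfolding u_def v_def
    using n norm_triangle_ineq2[of a "inf a b"] norm_triangle_ineq2[of b "inf a b"] by linarith+
  moreover have "u + v = sup a b - inf a b"
    using add_eq_inf_sup[of a b] unfolding u_def v_def
    by (metis add_diff_cancel_right' add_diff_eq diff_add_eq)
  then have "norm (u + v) \<le> r + d"
    using n norm_triangle_ineq4[of "sup a b" "inf a b"] by simp
  moreover have "0 \<le> u" "0 \<le> v" "inf u v = 0"
    unfolding u_def v_def by (rule disjoint_parts)+
  ultimately show ?case
    unfolding r_def[symmetric] by (intro exI[of _ u] exI[of _ v] conjI)
qed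

section \<open>Equality of the constants\<close>

theorem theorem4p5:
  fixes U :: "nat filter"
  assumes "free_ultrafilter U"
    and "\<exists>B :: 'a::banach_lattice set. independent B \<and> card B = 2"
  shows "lattice_schaffer (lattice_of TYPE('a)) = lattice_schaffer (lattice_of TYPE('a bidual)) \<and>
         lattice_schaffer (lattice_of TYPE('a bidual)) = lattice_schaffer (ultrapower U TYPE('a)) \<and>
         beta_const (lattice_of TYPE('a)) = beta_const (lattice_of TYPE('a bidual)) \<and>
         beta_const (lattice_of TYPE('a bidual)) = beta_const (ultrapower U TYPE('a))"
  using lattice_schaffer_bidual[where 'a = 'a] lattice_schaffer_ultrapower[OF assms(1), where 'a = 'a]
    beta_const_bidual[where 'a = 'a] beta_const_ultrapower[OF assms(1), where 'a = 'a]
  by simp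

end
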